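(* Let $R$ be a ring, $\sigma$ an automorphism of $R$, $\delta$ a locally nilpotent $\sigma$-derivation of $R$, and let $A=R(x;\sigma,\delta)$ be the skew Ore polynomial ring. Let $M_R$ be a right $R$-module. If $M[x^{-1}]_R$ is a completely $(\sigma,\delta)$-compatible Bass module, then $$\mathrm{Att}(M[x^{-1}]_A)=\{PA \mid P\in \mathrm{Att}(M_R)\}.$$
   Context: Rings are associative with identity, not necessarily commutative; modules are right modules; $\mathbb{N}$ includes $0$. A $\sigma$-derivation of $R$ is an additive map $\delta:R\to R$ with $\delta(rs)=\sigma(r)\delta(s)+\delta(r)s$ for all $r,s\in R$. It is locally nilpotent if for every $r\in R$ there is $n(r)\ge 1$ with $\delta^{n(r)}(r)=0$. Skew Ore polynomial ring: $A=R(x;\sigma,\delta)$ is the (associative) ring containing $R$ and generated by $R$ and $x$, whose elements are uniquely representable as $r_0+r_1x+\cdots+r_kx^k$ with $r_i\in R$, $k\in\mathbb{N}$, with commutation rule $xr=\sigma(r)x+x\delta(r)x$ for all $r\in R$; equivalently $xr=\sigma(r)x+\sigma\delta(r)x^2+\cdots+\sigma\delta^{n(r)-1}(r)x^{n(r)}$ where $\delta^{n(r)}(r)=0$. It is understood as part of the definition that these data do define such a ring. Compatibility: a right module $L_R$ is $\sigma$-compatible if for all $m\in L$, $r\in R$: $mr=0$ if and only if $m\sigma(r)=0$; it is $\delta$-compatible if $mr=0$ implies $m\delta(r)=0$. $L_R$ is completely $\sigma$-compatible (resp. completely $\delta$-compatible) if $(L/N)_R$ is $\sigma$-compatible (resp.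 $\delta$-compatible) for every submodule $N_R$ of $L_R$; it is completely $(\sigma,\delta)$-compatible if it is both. Bass module: $L_R$ is a Bass module if every proper submodule of $L_R$ is contained in a maximal submodule of $L_R$. Inverse polynomial module: put $\sigma'=\sigma^{-1}$ and $\delta'=-\delta\sigma^{-1}$. For $0\le i\le j$ let $f_j^i:R\to R$ be the additive map that is the sum of all possible words (compositions) in $\sigma',\delta'$ with $i$ letters $\sigma'$ and $j-i$ letters $\delta'$ ($f_0^0$ is the identity). $M[x^{-1}]$ is the additive group of all polynomials $m_0+m_1x^{-1}+\cdots+m_kx^{-k}$ with $m_i\in M$; $M[x^{-1}]_R$ is the right $R$-module with action $mx^{-k}r=\sum_{i=0}^k mf_k^i(r)x^{-i}$ (so $mx^{-1}r=m\sigma'(r)x^{-1}+m\delta'(r)$). $M[x^{-1}]_A$ is the right $A$-module given by this action together with $x^{-i}x^j=x^{-i+j}$ if $j\le i$, and $0$ otherwise; that is, $mx^{-k}(rx^j)=\sum_{i=j}^{k}mf_k^i(r)x^{-i+j}$ (zero if $j>k$). Attached primes: for a ring $B$, a right $B$-module $N_B$ is coprime if $N\ne 0$ and $\mathrm{ann}_B(N)=\mathrm{ann}_B(Q)$ for every nonzero quotient module $Q_B$ of $N_B$, where $\mathrm{ann}_B(N)=\{b\in B\mid Nb=0\}$. A right prime ideal $P$ of $B$ is attached to a right module $L_B$ if there is a coprime quotient module $Q_B$ of $L_B$ with $P=\mathrm{ann}_B(Q)$ (being an annihilator of a module, such a $P$ is a two-sided ideal, so this means a prime ideal). $\mathrm{Att}(L_B)$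 is the set of attached prime ideals of $L_B$. For an ideal $P$ of $R$, $PA$ is the right ideal of $A$ generated by $P$. *)

theory Defs
  imports "HOL-Algebra.UnivPoly" "HOL-Algebra.Ideal_Product" "HOL-Algebra.QuotRing"
begin

section \<open>Right modules over a noncommutative ring\<close>

text \<open>As in HOL-Algebra's record of (left) modules, the fields \<open>mult\<close> and \<open>one\<close> inherited from
  \<open>ring\<close> carry no meaning; only the additive group and the right action matter.\<close>

record ('a, 'b) rmodule = "'b ring" +
  ract :: "['b, 'a] \<Rightarrow> 'b" (infixl "\<bullet>\<index>" 70)

locale right_module = R?: ring R + M?: abelian_group M
  for R (structure) and M :: "('a, 'b, 'c) rmodule_scheme" (structure) +
  assumes ract_closed:
      "\<lbrakk>m \<in> carrier M; r \<in> carrier R\<rbrakk> \<Longrightarrow> m \<bullet>\<^bsub>M\<^esub> r \<in> carrier M"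
    and ract_l_distr:
      "\<lbrakk>m \<in> carrier M; n \<in> carrier M; r \<in> carrier R\<rbrakk> \<Longrightarrow>
        (m \<oplus>\<^bsub>M\<^esub> n) \<bullet>\<^bsub>M\<^esub> r = m \<bullet>\<^bsub>M\<^esub> r \<oplus>\<^bsub>M\<^esub> n \<bullet>\<^bsub>M\<^esub> r"
    and ract_r_distr:
      "\<lbrakk>m \<in> carrier M; r \<in> carrier R; s \<in> carrier R\<rbrakk> \<Longrightarrow>
        m \<bullet>\<^bsub>M\<^esub> (r \<oplus>\<^bsub>R\<^esub> s) = m \<bullet>\<^bsub>M\<^esub> r \<oplus>\<^bsub>M\<^esub> m \<bullet>\<^bsub>M\<^esub> s"
    and ract_assoc:
      "\<lbrakk>m \<in> carrier M; r \<in> carrier R; s \<in> carrier R\<rbrakk> \<Longrightarrow>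
        m \<bullet>\<^bsub>M\<^esub> (r \<otimes>\<^bsub>R\<^esub> s) = (m \<bullet>\<^bsub>M\<^esub> r) \<bullet>\<^bsub>M\<^esub> s"
    and ract_one:
      "m \<in> carrier M \<Longrightarrow> m \<bullet>\<^bsub>M\<^esub> \<one>\<^bsub>R\<^esub> = m"

definition rsubmodule ::
    "('a, 'u) ring_scheme \<Rightarrow> ('a, 'b, 'c) rmodule_scheme \<Rightarrow> 'b set \<Rightarrow> bool" where
  "rsubmodule R L N \<longleftrightarrow> additive_subgroup N L \<and>
     (\<forall>n\<in>N. \<forall>r\<in>carrier R. n \<bullet>\<^bsub>L\<^esub> r \<in> N)"

text \<open>The action on cosets is written like \<open>rcoset_mult\<close> for quotient rings.\<close>

definition rquot :: "('a, 'b, 'c) rmodule_scheme \<Rightarrow> 'b set \<Rightarrow> ('a, 'b set) rmodule" where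
  "rquot L N =
     \<lparr>carrier = a_rcosets\<^bsub>L\<^esub> N, mult = undefined, one = undefined,
      zero = N, add = set_add L,
      ract = (\<lambda>X r. \<Union>m\<in>X. N +>\<^bsub>L\<^esub> (m \<bullet>\<^bsub>L\<^esub> r))\<rparr>"

definition rann ::
    "('a, 'u) ring_scheme \<Rightarrow> ('a, 'b, 'c) rmodule_scheme \<Rightarrow> 'a set" where
  "rann B N = {b \<in> carrier B. \<forall>n\<in>carrier N. n \<bullet>\<^bsub>N\<^esub> b = \<zero>\<^bsub>N\<^esub>}"

definition maximal_rsubmodule ::
    "('a, 'u) ring_scheme \<Rightarrow> ('a, 'b, 'c) rmodule_scheme \<Rightarrow> 'b set \<Rightarrow> bool" where
  "maximal_rsubmodule R L K \<longleftrightarrow> rsubmodule R L K \<and> K \<noteq> carrier L \<and>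
     (\<forall>N. rsubmodule R L N \<and> K \<subseteq> N \<longrightarrow> N = K \<or> N = carrier L)"

definition bass_module ::
    "('a, 'u) ring_scheme \<Rightarrow> ('a, 'b, 'c) rmodule_scheme \<Rightarrow> bool" where
  "bass_module R L \<longleftrightarrow>
     (\<forall>N. rsubmodule R L N \<and> N \<noteq> carrier L \<longrightarrow> (\<exists>K. maximal_rsubmodule R L K \<and> N \<subseteq> K))"


section \<open>Attached primes\<close>

definition coprime_rmodule ::
    "('a, 'u) ring_scheme \<Rightarrow> ('a, 'b, 'c) rmodule_scheme \<Rightarrow> bool" where
  "coprime_rmodule B N \<longleftrightarrow> carrier N \<noteq> {\<zero>\<^bsub>N\<^esub>} \<and>
     (\<forall>K. rsubmodule B N K \<and> carrier (rquot N K) \<noteq> {\<zero>\<^bsub>rquot N K\<^esub>} \<longrightarrow>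
        rann B N = rann B (rquot N K))"

text \<open>The library's \<open>primeideal\<close> presupposes a commutative ring (and tests primeness on
  elements), hence the usual ideal-wise definition for noncommutative rings.\<close>

definition nc_prime_ideal :: "('a, 'u) ring_scheme \<Rightarrow> 'a set \<Rightarrow> bool" where
  "nc_prime_ideal B P \<longleftrightarrow> ideal P B \<and> P \<noteq> carrier B \<and>
     (\<forall>I J. ideal I B \<and> ideal J B \<and> I \<cdot>\<^bsub>B\<^esub> J \<subseteq> P \<longrightarrow> I \<subseteq> P \<or> J \<subseteq> P)"

definition Att ::
    "('a, 'u) ring_scheme \<Rightarrow> ('a, 'b, 'c) rmodule_scheme \<Rightarrow> 'a set set" where
  "Att B L = {P. nc_prime_ideal B P \<and>
     (\<exists>N. rsubmodule B L N \<and> coprime_rmodule B (rquot L N) \<and> P = rann B (rquot L N))}"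


section \<open>Skew derivations and compatibility\<close>

definition skew_derivation ::
    "('a, 'u) ring_scheme \<Rightarrow> ('a \<Rightarrow> 'a) \<Rightarrow> ('a \<Rightarrow> 'a) \<Rightarrow> bool" where
  "skew_derivation R \<sigma> \<delta> \<longleftrightarrow> \<delta> \<in> carrier R \<rightarrow> carrier R \<and>
     (\<forall>r\<in>carrier R. \<forall>s\<in>carrier R.
        \<delta> (r \<oplus>\<^bsub>R\<^esub> s) = \<delta> r \<oplus>\<^bsub>R\<^esub> \<delta> s \<and>
        \<delta> (r \<otimes>\<^bsub>R\<^esub> s) = \<sigma> r \<otimes>\<^bsub>R\<^esub> \<delta> s \<oplus>\<^bsub>R\<^esub> \<delta> r \<otimes>\<^bsub>R\<^esub> s)"

definition locally_nilpotent :: "('a, 'u) ring_scheme \<Rightarrow> ('a \<Rightarrow> 'a) \<Rightarrow> bool" where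
  "locally_nilpotent R \<delta> \<longleftrightarrow> (\<forall>r\<in>carrier R. \<exists>n\<ge>1. (\<delta> ^^ n) r = \<zero>\<^bsub>R\<^esub>)"

definition sigma_compatible ::
    "('a, 'u) ring_scheme \<Rightarrow> ('a \<Rightarrow> 'a) \<Rightarrow> ('a, 'b, 'c) rmodule_scheme \<Rightarrow> bool" where
  "sigma_compatible R \<sigma> L \<longleftrightarrow> (\<forall>m\<in>carrier L. \<forall>r\<in>carrier R.
     m \<bullet>\<^bsub>L\<^esub> r = \<zero>\<^bsub>L\<^esub> \<longleftrightarrow> m \<bullet>\<^bsub>L\<^esub> \<sigma> r = \<zero>\<^bsub>L\<^esub>)"

definition delta_compatible ::
    "('a, 'u) ring_scheme \<Rightarrow> ('a \<Rightarrow> 'a) \<Rightarrow> ('a, 'b, 'c) rmodule_scheme \<Rightarrow> bool" where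
  "delta_compatible R \<delta> L \<longleftrightarrow> (\<forall>m\<in>carrier L. \<forall>r\<in>carrier R.
     m \<bullet>\<^bsub>L\<^esub> r = \<zero>\<^bsub>L\<^esub> \<longrightarrow> m \<bullet>\<^bsub>L\<^esub> \<delta> r = \<zero>\<^bsub>L\<^esub>)"

definition completely_compatible ::
    "('a, 'u) ring_scheme \<Rightarrow> ('a \<Rightarrow> 'a) \<Rightarrow> ('a \<Rightarrow> 'a) \<Rightarrow> ('a, 'b, 'c) rmodule_scheme \<Rightarrow> bool" where
  "completely_compatible R \<sigma> \<delta> L \<longleftrightarrow> (\<forall>N. rsubmodule R L N \<longrightarrow>
     sigma_compatible R \<sigma> (rquot L N) \<and> delta_compatible R \<delta> (rquot L N))"


section \<open>Skew Ore polynomial rings\<close>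

text \<open>\<open>R\<close> is contained in \<open>A\<close> by means of an injective ring homomorphism \<open>\<iota>\<close>, so that the two
  rings may live on different types. A polynomial \<open>r\<^sub>0 + r\<^sub>1 x + \<dots> + r\<^sub>k x\<^sup>k\<close> is given by its
  finitely supported coefficient sequence, an element of \<open>up R\<close>; this makes the
  representation unique irrespective of trailing zero coefficients.\<close>

definition skew_eval ::
    "('a, 'u) ring_scheme \<Rightarrow> ('d, 'v) ring_scheme \<Rightarrow> ('a \<Rightarrow> 'd) \<Rightarrow> 'd \<Rightarrow> (nat \<Rightarrow> 'a) \<Rightarrow> 'd" where
  "skew_eval R A \<iota> x c = (\<Oplus>\<^bsub>A\<^esub>j\<in>{j. c j \<noteq> \<zero>\<^bsub>R\<^esub>}. \<iota> (c j) \<otimes>\<^bsub>A\<^esub> x [^]\<^bsub>A\<^esub> j)"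

text \<open>That \<open>A\<close> is generated by \<open>R\<close> and \<open>x\<close> is subsumed by the last condition.\<close>

definition skew_ore_ring ::
    "('a, 'u) ring_scheme \<Rightarrow> ('a \<Rightarrow> 'a) \<Rightarrow> ('a \<Rightarrow> 'a) \<Rightarrow>
     ('d, 'v) ring_scheme \<Rightarrow> ('a \<Rightarrow> 'd) \<Rightarrow> 'd \<Rightarrow> bool" where
  "skew_ore_ring R \<sigma> \<delta> A \<iota> x \<longleftrightarrow>
     ring A \<and> \<iota> \<in> ring_hom R A \<and> inj_on \<iota> (carrier R) \<and> x \<in> carrier A \<and>
     (\<forall>r\<in>carrier R. x \<otimes>\<^bsub>A\<^esub> \<iota> r =
        \<iota> (\<sigma> r) \<otimes>\<^bsub>A\<^esub> x \<oplus>\<^bsub>A\<^esub> x \<otimes>\<^bsub>A\<^esub> \<iota> (\<delta> r) \<otimes>\<^bsub>A\<^esub> x) \<and>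
     (\<forall>a\<in>carrier A. \<exists>!c. c \<in> up R \<and> a = skew_eval R A \<iota> x c)"

definition skew_coeffs ::
    "('a, 'u) ring_scheme \<Rightarrow> ('d, 'v) ring_scheme \<Rightarrow> ('a \<Rightarrow> 'd) \<Rightarrow> 'd \<Rightarrow> 'd \<Rightarrow> nat \<Rightarrow> 'a" where
  "skew_coeffs R A \<iota> x a = (THE c. c \<in> up R \<and> a = skew_eval R A \<iota> x c)"

definition right_ideal :: "'d set \<Rightarrow> ('d, 'v) ring_scheme \<Rightarrow> bool" where
  "right_ideal I A \<longleftrightarrow> additive_subgroup I A \<and>
     (\<forall>a\<in>I. \<forall>b\<in>carrier A. a \<otimes>\<^bsub>A\<^esub> b \<in> I)"

definition gen_right_ideal :: "('d, 'v) ring_scheme \<Rightarrow> 'd set \<Rightarrow> 'd set" where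
  "gen_right_ideal A S = \<Inter>{I. right_ideal I A \<and> S \<subseteq> I}"


section \<open>Inverse polynomial modules\<close>

definition sigma_inv ::
    "('a, 'u) ring_scheme \<Rightarrow> ('a \<Rightarrow> 'a) \<Rightarrow> 'a \<Rightarrow> 'a" where
  "sigma_inv R \<sigma> = inv_into (carrier R) \<sigma>"

definition delta_inv ::
    "('a, 'u) ring_scheme \<Rightarrow> ('a \<Rightarrow> 'a) \<Rightarrow> ('a \<Rightarrow> 'a) \<Rightarrow> 'a \<Rightarrow> 'a" where
  "delta_inv R \<sigma> \<delta> r = \<ominus>\<^bsub>R\<^esub> \<delta> (sigma_inv R \<sigma> r)"

text \<open>\<open>word_sum R \<sigma> \<delta> j i\<close> is \<open>f\<^sub>j\<^sup>i\<close>. A word is a Boolean list, where \<open>True\<close> stands for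
  the letter \<open>\<sigma>' = \<sigma>\<inverse>\<close> and \<open>False\<close> for \<open>\<delta>' = - \<delta> \<sigma>\<inverse>\<close>.\<close>

definition word_sum ::
    "('a, 'u) ring_scheme \<Rightarrow> ('a \<Rightarrow> 'a) \<Rightarrow> ('a \<Rightarrow> 'a) \<Rightarrow> nat \<Rightarrow> nat \<Rightarrow> 'a \<Rightarrow> 'a" where
  "word_sum R \<sigma> \<delta> j i r =
     (\<Oplus>\<^bsub>R\<^esub>w\<in>{w :: bool list. length w = j \<and> count_list w True = i}.
        foldr (\<lambda>b. if b then sigma_inv R \<sigma> else delta_inv R \<sigma> \<delta>) w r)"

text \<open>An inverse polynomial is its coefficient sequence \<open>f \<in> up M\<close>, with \<open>f k\<close> the coefficient
  of \<open>x\<^sup>-\<^sup>k\<close>. The actions below are the additive extensions of the formulas for \<open>m x\<^sup>-\<^sup>k r\<close> and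
  \<open>m x\<^sup>-\<^sup>k (r x\<^sup>j)\<close>, sorted by powers of \<open>x\<inverse>\<close>: the coefficient of \<open>x\<^sup>-\<^sup>i\<close> in \<open>f r\<close> is the
  sum of the \<open>f k f\<^sub>k\<^sup>i(r)\<close> over \<open>k \<ge> i\<close>, and the coefficient of \<open>x\<^sup>-\<^sup>l\<close> in \<open>f (r x\<^sup>j)\<close> is the
  coefficient of \<open>x\<^sup>-\<^sup>(\<^sup>l\<^sup>+\<^sup>j\<^sup>)\<close> in \<open>f r\<close>.\<close>

definition inv_poly_ract ::
    "('a, 'u) ring_scheme \<Rightarrow> ('a \<Rightarrow> 'a) \<Rightarrow> ('a \<Rightarrow> 'a) \<Rightarrow> ('a, 'b, 'c) rmodule_scheme \<Rightarrow>
     (nat \<Rightarrow> 'b) \<Rightarrow> 'a \<Rightarrow> nat \<Rightarrow> 'b" where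
  "inv_poly_ract R \<sigma> \<delta> M f r i =
     (\<Oplus>\<^bsub>M\<^esub>k\<in>{k. i \<le> k \<and> f k \<noteq> \<zero>\<^bsub>M\<^esub>}. f k \<bullet>\<^bsub>M\<^esub> word_sum R \<sigma> \<delta> k i r)"

definition inv_poly_R ::
    "('a, 'u) ring_scheme \<Rightarrow> ('a \<Rightarrow> 'a) \<Rightarrow> ('a \<Rightarrow> 'a) \<Rightarrow> ('a, 'b, 'c) rmodule_scheme \<Rightarrow>
     ('a, nat \<Rightarrow> 'b) rmodule" where
  "inv_poly_R R \<sigma> \<delta> M =
     \<lparr>carrier = up M, mult = undefined, one = undefined,
      zero = (\<lambda>_. \<zero>\<^bsub>M\<^esub>), add = (\<lambda>f g i. f i \<oplus>\<^bsub>M\<^esub> g i),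
      ract = inv_poly_ract R \<sigma> \<delta> M\<rparr>"

definition inv_poly_A ::
    "('a, 'u) ring_scheme \<Rightarrow> ('a \<Rightarrow> 'a) \<Rightarrow> ('a \<Rightarrow> 'a) \<Rightarrow>
     ('d, 'v) ring_scheme \<Rightarrow> ('a \<Rightarrow> 'd) \<Rightarrow> 'd \<Rightarrow> ('a, 'b, 'c) rmodule_scheme \<Rightarrow>
     ('d, nat \<Rightarrow> 'b) rmodule" where
  "inv_poly_A R \<sigma> \<delta> A \<iota> x M =
     \<lparr>carrier = up M, mult = undefined, one = undefined,
      zero = (\<lambda>_. \<zero>\<^bsub>M\<^esub>), add = (\<lambda>f g i. f i \<oplus>\<^bsub>M\<^esub> g i),
      ract = (\<lambda>f a l. let c = skew_coeffs R A \<iota> x a in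
        \<Oplus>\<^bsub>M\<^esub>j\<in>{j. c j \<noteq> \<zero>\<^bsub>R\<^esub>}. inv_poly_ract R \<sigma> \<delta> M f (c j) (l + j))\<rparr>"

end

theory Submission
  imports Defs
begin

text \<open>
  Let \<open>lead K k\<close> be the submodule of \<open>M\<close> of coefficients of \<open>x\<^sup>-\<^sup>k\<close> in the elements of degree at most
  \<open>k\<close> of an \<open>R\<close>-submodule \<open>K\<close> of \<open>M[x\<inverse>]\<close>; it is proper for some \<open>k\<close> as soon as \<open>K\<close> is proper. If
  \<open>P\<close> annihilates \<open>M / lead K k\<close> and \<open>M[x\<inverse>] P\<close> and its shifts lie in \<open>K\<close>, then comparing
  leading coefficients of \<open>m x\<^sup>-\<^sup>k\<^sup>-\<^sup>j a\<close>, with \<open>P\<close> stable under \<open>\<sigma>\<close> and \<open>\<delta>\<close> by compatibility, shows that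
  \<open>M[x\<inverse>] a\<close> lies in \<open>K\<close> if and only if all coefficients of \<open>a\<close> lie in \<open>P\<close>.

  For \<open>M / N\<close> coprime this applies to every proper \<open>A\<close>-submodule \<open>K\<close> above \<open>N[x\<inverse>]\<close>, so
  \<open>M[x\<inverse>] / N[x\<inverse>]\<close> is coprime. Conversely, for \<open>M[x\<inverse>] / K\<close> coprime let \<open>H\<close> be a maximal
  \<open>R\<close>-submodule above \<open>K\<close> and \<open>k\<close> minimal with \<open>lead H k\<close> proper. Then \<open>lead H k\<close> is maximal in \<open>M\<close>,
  and with \<open>P\<close> the annihilator of \<open>M / lead H k\<close> the observation applies to \<open>H\<close>. The largest
  \<open>A\<close>-submodule inside \<open>H\<close> contains \<open>K\<close> and \<open>M[x\<inverse>] P\<close>, and its quotient has the same annihilator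
  as \<open>M[x\<inverse>] / K\<close>.
\<close>

section \<open>Quotients, annihilators and attached primes of right modules\<close>

text \<open>The annihilator of the quotient \<open>L / N\<close>, phrased without cosets (see
  \<open>rann_rquot\<close>). Attached primes are handled through it from here on, and it makes
  sense even when \<open>N\<close> is not stable under all of \<open>B\<close>.\<close>

definition colon ::
    "('a, 'u) ring_scheme \<Rightarrow> ('a, 'b, 'c) rmodule_scheme \<Rightarrow> 'b set \<Rightarrow> 'a set" where
  "colon B L N = {b \<in> carrier B. \<forall>v\<in>carrier L. v \<bullet>\<^bsub>L\<^esub> b \<in> N}"

lemma colonD: "b \<in> colon B L N \<Longrightarrow> v \<in> carrier L \<Longrightarrow> v \<bullet>\<^bsub>L\<^esub> b \<in> N"
  by (simp add: colon_def)

lemma colon_carrier: "b \<in> colon B L N \<Longrightarrow> b \<in> carrier B"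
  by (simp add: colon_def)

lemma colon_mono: "N \<subseteq> K \<Longrightarrow> colon B L N \<subseteq> colon B L K"
  by (auto simp: colon_def)

lemma additive_subgroup_iff:
  assumes "abelian_group L"
  shows "additive_subgroup N L \<longleftrightarrow> N \<subseteq> carrier L \<and> \<zero>\<^bsub>L\<^esub> \<in> N \<and>
    (\<forall>a\<in>N. \<forall>b\<in>N. a \<oplus>\<^bsub>L\<^esub> b \<in> N) \<and> (\<forall>a\<in>N. \<ominus>\<^bsub>L\<^esub> a \<in> N)"
  by (auto simp: additive_subgroup_def subgroup_def a_inv_def)

context right_module
begin

lemma zero_ract: "r \<in> carrier R \<Longrightarrow> \<zero>\<^bsub>M\<^esub> \<bullet>\<^bsub>M\<^esub> r = \<zero>\<^bsub>M\<^esub>"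
  using ract_l_distr[of "\<zero>\<^bsub>M\<^esub>" "\<zero>\<^bsub>M\<^esub>" r]
  by (simp add: ract_closed M.add.r_cancel_one)

lemma ract_zero: "m \<in> carrier M \<Longrightarrow> m \<bullet>\<^bsub>M\<^esub> \<zero>\<^bsub>R\<^esub> = \<zero>\<^bsub>M\<^esub>"
  using ract_r_distr[of m "\<zero>\<^bsub>R\<^esub>" "\<zero>\<^bsub>R\<^esub>"]
  by (simp add: ract_closed M.add.r_cancel_one)

lemma ract_minus:
  assumes "m \<in> carrier M" "r \<in> carrier R"
  shows "m \<bullet>\<^bsub>M\<^esub> (\<ominus>\<^bsub>R\<^esub> r) = \<ominus>\<^bsub>M\<^esub> (m \<bullet>\<^bsub>M\<^esub> r)"
  using assms ract_r_distr[of m "\<ominus>\<^bsub>R\<^esub> r" r]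
  by (intro M.minus_equality[symmetric]) (auto simp: R.l_neg ract_zero ract_closed)

text \<open>Closure under negation comes from the action, since \<open>-a = a (-1)\<close>; later
  submodule proofs therefore check only zero, sums and the action.\<close>

lemma rsubmodule_iff:
  "rsubmodule R M N \<longleftrightarrow> N \<subseteq> carrier M \<and> \<zero>\<^bsub>M\<^esub> \<in> N \<and>
    (\<forall>a\<in>N. \<forall>b\<in>N. a \<oplus>\<^bsub>M\<^esub> b \<in> N) \<and> (\<forall>a\<in>N. \<forall>r\<in>carrier R. a \<bullet>\<^bsub>M\<^esub> r \<in> N)"
    (is "?L \<longleftrightarrow> ?R")
proof
  assume ?R
  have "\<ominus>\<^bsub>M\<^esub> a \<in> N" if "a \<in> N" for a
  proof -
    have "a \<in> carrier M" using that \<open>?R\<close> by auto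
    then have "\<ominus>\<^bsub>M\<^esub> a = a \<bullet>\<^bsub>M\<^esub> (\<ominus>\<^bsub>R\<^esub> \<one>\<^bsub>R\<^esub>)" by (simp add: ract_minus ract_one)
    also have "\<dots> \<in> N" using that \<open>?R\<close> by auto
    finally show ?thesis .
  qed
  with \<open>?R\<close> show ?L
    by (simp add: rsubmodule_def additive_subgroup_iff[OF M.abelian_group_axioms])
qed (auto simp: rsubmodule_def additive_subgroup_iff[OF M.abelian_group_axioms])

lemma rsubmodule_sub: "rsubmodule R M N \<Longrightarrow> N \<subseteq> carrier M"
  and rsubmodule_zero: "rsubmodule R M N \<Longrightarrow> \<zero>\<^bsub>M\<^esub> \<in> N"
  and rsubmodule_add: "rsubmodule R M N \<Longrightarrow> a \<in> N \<Longrightarrow> b \<in> N \<Longrightarrow> a \<oplus>\<^bsub>M\<^esub> b \<in> N"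
  and rsubmodule_ract: "rsubmodule R M N \<Longrightarrow> a \<in> N \<Longrightarrow> r \<in> carrier R \<Longrightarrow> a \<bullet>\<^bsub>M\<^esub> r \<in> N"
  by (auto simp: rsubmodule_iff)

lemma rsubmodule_minus: "rsubmodule R M N \<Longrightarrow> a \<in> N \<Longrightarrow> \<ominus>\<^bsub>M\<^esub> a \<in> N"
  by (auto simp: rsubmodule_def additive_subgroup_iff[OF M.abelian_group_axioms])

lemma rsubmodule_diff: "rsubmodule R M N \<Longrightarrow> a \<in> N \<Longrightarrow> b \<in> N \<Longrightarrow> a \<ominus>\<^bsub>M\<^esub> b \<in> N"
  by (simp add: a_minus_def rsubmodule_add rsubmodule_minus)

lemma rsubmodule_add_cancel:
  assumes "rsubmodule R M N" "a \<in> N" "b \<in> carrier M" "a \<oplus>\<^bsub>M\<^esub> b \<in> N"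
  shows "b \<in> N"
proof -
  have a: "a \<in> carrier M" using assms rsubmodule_sub by blast
  have "b = (a \<oplus>\<^bsub>M\<^esub> b) \<ominus>\<^bsub>M\<^esub> a"
    using a assms(3) by (simp add: a_minus_def M.a_comm[of a b] M.a_assoc M.r_neg)
  with rsubmodule_diff[OF assms(1,4,2)] show ?thesis by simp
qed

lemma set_addI: "a \<in> N \<Longrightarrow> b \<in> K \<Longrightarrow> a \<oplus>\<^bsub>M\<^esub> b \<in> N <+>\<^bsub>M\<^esub> K"
  by (auto simp: set_add_def')

lemma rsubmodule_set_add:
  assumes N: "rsubmodule R M N" and K: "rsubmodule R M K"
  shows "rsubmodule R M (N <+>\<^bsub>M\<^esub> K)"
  unfolding rsubmodule_iff
proof (intro conjI ballI)
  show "N <+>\<^bsub>M\<^esub> K \<subseteq> carrier M"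
    using rsubmodule_sub[OF N] rsubmodule_sub[OF K] by (auto simp: set_add_def' subset_iff)
  show "\<zero>\<^bsub>M\<^esub> \<in> N <+>\<^bsub>M\<^esub> K"
    using rsubmodule_zero[OF N] rsubmodule_zero[OF K] by (force simp: set_add_def')
next
  fix a b assume "a \<in> N <+>\<^bsub>M\<^esub> K" "b \<in> N <+>\<^bsub>M\<^esub> K"
  then obtain n k n' k' where *: "a = n \<oplus>\<^bsub>M\<^esub> k" "b = n' \<oplus>\<^bsub>M\<^esub> k'" "n \<in> N" "k \<in> K" "n' \<in> N" "k' \<in> K"
    by (auto simp: set_add_def')
  then have "n \<in> carrier M" "k \<in> carrier M" "n' \<in> carrier M" "k' \<in> carrier M"
    using rsubmodule_sub[OF N] rsubmodule_sub[OF K] by auto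
  then have ab: "a \<oplus>\<^bsub>M\<^esub> b = (n \<oplus>\<^bsub>M\<^esub> n') \<oplus>\<^bsub>M\<^esub> (k \<oplus>\<^bsub>M\<^esub> k')" using * by (simp add: M.a_ac)
  show "a \<oplus>\<^bsub>M\<^esub> b \<in> N <+>\<^bsub>M\<^esub> K"
    unfolding ab using * by (intro set_addI rsubmodule_add[OF N] rsubmodule_add[OF K])
next
  fix a r assume "a \<in> N <+>\<^bsub>M\<^esub> K" and r: "r \<in> carrier R"
  then obtain n k where *: "a = n \<oplus>\<^bsub>M\<^esub> k" "n \<in> N" "k \<in> K" by (auto simp: set_add_def')
  then have ar: "a \<bullet>\<^bsub>M\<^esub> r = n \<bullet>\<^bsub>M\<^esub> r \<oplus>\<^bsub>M\<^esub> k \<bullet>\<^bsub>M\<^esub> r"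
    using r rsubmodule_sub[OF N] rsubmodule_sub[OF K] by (auto simp: ract_l_distr subset_iff)
  show "a \<bullet>\<^bsub>M\<^esub> r \<in> N <+>\<^bsub>M\<^esub> K"
    unfolding ar using * r by (intro set_addI rsubmodule_ract[OF N] rsubmodule_ract[OF K])
qed

lemma rsubmodule_abelian_subgroup: "rsubmodule R M N \<Longrightarrow> abelian_subgroup N M"
  using M.abelian_group_axioms by (auto simp: rsubmodule_def intro: abelian_subgroupI3)

lemma coset_eq_self_iff:
  assumes "rsubmodule R M N" "v \<in> carrier M"
  shows "N +>\<^bsub>M\<^esub> v = N \<longleftrightarrow> v \<in> N"
proof -
  interpret abelian_subgroup N M using rsubmodule_abelian_subgroup[OF assms(1)] .
  show ?thesis using assms(2) a_rcos_self a_rcos_const by metis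
qed

lemma rquot_ract:
  assumes N: "rsubmodule R M N" and v: "v \<in> carrier M" and r: "r \<in> carrier R"
  shows "(N +>\<^bsub>M\<^esub> v) \<bullet>\<^bsub>rquot M N\<^esub> r = N +>\<^bsub>M\<^esub> (v \<bullet>\<^bsub>M\<^esub> r)"
proof -
  interpret abelian_subgroup N M using rsubmodule_abelian_subgroup[OF N] .
  \<comment> \<open>All members of one coset lead to the same coset, so the union that defines the
    action on \<open>rquot M N\<close> is a union of equal sets.\<close>
  have const: "N +>\<^bsub>M\<^esub> (m \<bullet>\<^bsub>M\<^esub> r) = N +>\<^bsub>M\<^esub> (v \<bullet>\<^bsub>M\<^esub> r)" if "m \<in> N +>\<^bsub>M\<^esub> v" for m
  proof -
    obtain n where n: "n \<in> N" "m = n \<oplus>\<^bsub>M\<^esub> v" using \<open>m \<in> N +>\<^bsub>M\<^esub> v\<close> by (auto simp: a_r_coset_def')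
    then have "m \<bullet>\<^bsub>M\<^esub> r = n \<bullet>\<^bsub>M\<^esub> r \<oplus>\<^bsub>M\<^esub> v \<bullet>\<^bsub>M\<^esub> r"
      using v r rsubmodule_sub[OF N] by (auto simp: ract_l_distr)
    then have "m \<bullet>\<^bsub>M\<^esub> r \<in> N +>\<^bsub>M\<^esub> (v \<bullet>\<^bsub>M\<^esub> r)"
      using rsubmodule_ract[OF N n(1) r] by (auto simp: a_r_coset_def')
    then show ?thesis using a_repr_independence'[of "m \<bullet>\<^bsub>M\<^esub> r" "v \<bullet>\<^bsub>M\<^esub> r"] v r ract_closed by simp
  qed
  have "(\<Union>m\<in>N +>\<^bsub>M\<^esub> v. N +>\<^bsub>M\<^esub> (m \<bullet>\<^bsub>M\<^esub> r)) = N +>\<^bsub>M\<^esub> (v \<bullet>\<^bsub>M\<^esub> r)"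
  proof (rule SUP_eq_const)
    show "N +>\<^bsub>M\<^esub> v \<noteq> {}" using a_rcos_self[OF v] by blast
  qed (rule const)
  then show ?thesis by (simp only: rquot_def rmodule.select_convs)
qed

lemma rquot_carrier: "carrier (rquot M N) = (\<lambda>v. N +>\<^bsub>M\<^esub> v) ` carrier M"
  by (auto simp: rquot_def A_RCOSETS_def')

lemma right_module_rquot:
  assumes N: "rsubmodule R M N"
  shows "right_module R (rquot M N)"
proof -
  interpret abelian_subgroup N M using rsubmodule_abelian_subgroup[OF N] .
  have add: "(N +>\<^bsub>M\<^esub> v) \<oplus>\<^bsub>rquot M N\<^esub> (N +>\<^bsub>M\<^esub> w) = N +>\<^bsub>M\<^esub> (v \<oplus>\<^bsub>M\<^esub> w)"
    if "v \<in> carrier M" "w \<in> carrier M" for v w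
    using a_rcos_sum[OF that] by (simp add: rquot_def)
  have zero: "\<zero>\<^bsub>rquot M N\<^esub> = N +>\<^bsub>M\<^esub> \<zero>\<^bsub>M\<^esub>"
    using coset_eq_self_iff[OF N, of "\<zero>\<^bsub>M\<^esub>"] by (simp add: rquot_def)
  have "abelian_group (rquot M N)"
  proof (rule abelian_groupI, goal_cases)
    case (6 x)
    then obtain v where v: "v \<in> carrier M" "x = N +>\<^bsub>M\<^esub> v" by (auto simp: rquot_carrier)
    then have "(N +>\<^bsub>M\<^esub> (\<ominus>\<^bsub>M\<^esub> v)) \<oplus>\<^bsub>rquot M N\<^esub> x = \<zero>\<^bsub>rquot M N\<^esub>"
      by (simp add: add zero M.l_neg)
    with v show ?case by (auto simp: rquot_carrier)
  qed (auto simp: rquot_carrier add zero M.a_ac)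
  then show ?thesis
    by (intro right_module.intro right_module_axioms.intro R.ring_axioms)
      (auto simp: rquot_carrier rquot_ract[OF N] add ract_closed ract_l_distr ract_r_distr
        ract_assoc ract_one)
qed

lemma rann_rquot:
  assumes N: "rsubmodule R M N"
  shows "rann R (rquot M N) = colon R M N"
proof -
  have "\<zero>\<^bsub>rquot M N\<^esub> = N" by (simp add: rquot_def)
  moreover have "(N +>\<^bsub>M\<^esub> v) \<bullet>\<^bsub>rquot M N\<^esub> b = N \<longleftrightarrow> v \<bullet>\<^bsub>M\<^esub> b \<in> N"
    if "v \<in> carrier M" "b \<in> carrier R" for v b
    using that by (simp add: rquot_ract[OF N] coset_eq_self_iff[OF N] ract_closed)
  ultimately show ?thesis
    unfolding rann_def colon_def rquot_carrier by blast
qed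

lemma rquot_trivial_iff:
  assumes N: "rsubmodule R M N"
  shows "carrier (rquot M N) = {\<zero>\<^bsub>rquot M N\<^esub>} \<longleftrightarrow> N = carrier M"
proof -
  have "\<zero>\<^bsub>rquot M N\<^esub> = N" by (simp add: rquot_def)
  moreover have "(\<lambda>v. N +>\<^bsub>M\<^esub> v) ` carrier M = {N} \<longleftrightarrow> (\<forall>v\<in>carrier M. N +>\<^bsub>M\<^esub> v = N)"
    by auto
  ultimately show ?thesis
    using rsubmodule_sub[OF N] by (auto simp: rquot_carrier coset_eq_self_iff[OF N])
qed

section \<open>Coprime quotients and attached primes without cosets\<close>

lemma coprime_rmodule_iff:
  "coprime_rmodule R M \<longleftrightarrow> carrier M \<noteq> {\<zero>\<^bsub>M\<^esub>} \<and>
    (\<forall>K. rsubmodule R M K \<and> K \<noteq> carrier M \<longrightarrow> rann R M = colon R M K)"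
  unfolding coprime_rmodule_def using rquot_trivial_iff rann_rquot by metis

text \<open>One half of the correspondence theorem. The second and third claims rest on
  \<open>mem\<close>: as \<open>K\<close> contains \<open>N\<close>, a coset lies in the image of
  \<open>K\<close> only if its representatives lie in \<open>K\<close>.\<close>

lemma rsubmodule_colon_quotient:
  assumes N: "rsubmodule R M N" and K: "rsubmodule R M K" and NK: "N \<subseteq> K"
  shows "rsubmodule R (rquot M N) ((\<lambda>v. N +>\<^bsub>M\<^esub> v) ` K)"
    and "colon R (rquot M N) ((\<lambda>v. N +>\<^bsub>M\<^esub> v) ` K) = colon R M K"
    and "(\<lambda>v. N +>\<^bsub>M\<^esub> v) ` K = carrier (rquot M N) \<longleftrightarrow> K = carrier M"
proof -
  interpret abelian_subgroup N M using rsubmodule_abelian_subgroup[OF N] .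
  interpret Q: right_module R "rquot M N" using right_module_rquot[OF N] .
  have K': "K \<subseteq> carrier M" using rsubmodule_sub[OF K] .
  have mem: "N +>\<^bsub>M\<^esub> v \<in> (\<lambda>v. N +>\<^bsub>M\<^esub> v) ` K \<longleftrightarrow> v \<in> K" if v: "v \<in> carrier M" for v
  proof
    assume "N +>\<^bsub>M\<^esub> v \<in> (\<lambda>v. N +>\<^bsub>M\<^esub> v) ` K"
    then obtain k where k: "k \<in> K" "N +>\<^bsub>M\<^esub> v = N +>\<^bsub>M\<^esub> k" by auto
    then have "v \<in> N +>\<^bsub>M\<^esub> k" using a_rcos_self[OF v] by simp
    then obtain n where "n \<in> N" "v = n \<oplus>\<^bsub>M\<^esub> k" by (auto simp: a_r_coset_def')
    then show "v \<in> K" using rsubmodule_add[OF K] k NK by auto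
  qed auto
  have add: "(N +>\<^bsub>M\<^esub> v) \<oplus>\<^bsub>rquot M N\<^esub> (N +>\<^bsub>M\<^esub> w) = N +>\<^bsub>M\<^esub> (v \<oplus>\<^bsub>M\<^esub> w)"
    if "v \<in> carrier M" "w \<in> carrier M" for v w
    using a_rcos_sum[OF that] by (simp add: rquot_def)
  have zero: "\<zero>\<^bsub>rquot M N\<^esub> = N +>\<^bsub>M\<^esub> \<zero>\<^bsub>M\<^esub>"
    using coset_eq_self_iff[OF N, of "\<zero>\<^bsub>M\<^esub>"] by (simp add: rquot_def)
  show "rsubmodule R (rquot M N) ((\<lambda>v. N +>\<^bsub>M\<^esub> v) ` K)"
    unfolding Q.rsubmodule_iff
  proof (intro conjI ballI)
    fix a b assume "a \<in> (\<lambda>v. N +>\<^bsub>M\<^esub> v) ` K" "b \<in> (\<lambda>v. N +>\<^bsub>M\<^esub> v) ` K"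
    then show "a \<oplus>\<^bsub>rquot M N\<^esub> b \<in> (\<lambda>v. N +>\<^bsub>M\<^esub> v) ` K"
      using K' rsubmodule_add[OF K] by (auto simp: add subset_iff)
  next
    fix a r assume "a \<in> (\<lambda>v. N +>\<^bsub>M\<^esub> v) ` K" "r \<in> carrier R"
    then show "a \<bullet>\<^bsub>rquot M N\<^esub> r \<in> (\<lambda>v. N +>\<^bsub>M\<^esub> v) ` K"
      using K' rsubmodule_ract[OF K] by (auto simp: rquot_ract[OF N] subset_iff)
  qed (use K' rsubmodule_zero[OF K] in \<open>auto simp: rquot_carrier zero\<close>)
  show "colon R (rquot M N) ((\<lambda>v. N +>\<^bsub>M\<^esub> v) ` K) = colon R M K"
    by (auto simp: colon_def rquot_carrier rquot_ract[OF N] mem ract_closed)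
  show "(\<lambda>v. N +>\<^bsub>M\<^esub> v) ` K = carrier (rquot M N) \<longleftrightarrow> K = carrier M"
  proof
    assume *: "(\<lambda>v. N +>\<^bsub>M\<^esub> v) ` K = carrier (rquot M N)"
    have "v \<in> K" if "v \<in> carrier M" for v
      using mem[OF that] that unfolding * by (simp add: rquot_carrier)
    with K' show "K = carrier M" by auto
  qed (simp add: rquot_carrier)
qed

lemma rsubmodule_preimage:
  assumes N: "rsubmodule R M N" and K: "rsubmodule R (rquot M N) K"
  obtains K' where "rsubmodule R M K'" "N \<subseteq> K'" "K = (\<lambda>v. N +>\<^bsub>M\<^esub> v) ` K'"
proof
  interpret abelian_subgroup N M using rsubmodule_abelian_subgroup[OF N] .
  interpret Q: right_module R "rquot M N" using right_module_rquot[OF N] .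
  let ?K = "{v \<in> carrier M. N +>\<^bsub>M\<^esub> v \<in> K}"
  have add: "N +>\<^bsub>M\<^esub> (v \<oplus>\<^bsub>M\<^esub> w) = (N +>\<^bsub>M\<^esub> v) \<oplus>\<^bsub>rquot M N\<^esub> (N +>\<^bsub>M\<^esub> w)"
    if "v \<in> carrier M" "w \<in> carrier M" for v w
    using a_rcos_sum[OF that] by (simp add: rquot_def)
  have zero: "\<zero>\<^bsub>rquot M N\<^esub> = N" by (simp add: rquot_def)
  have "N \<in> K" using Q.rsubmodule_zero[OF K] zero by simp
  then show NK: "N \<subseteq> ?K"
    using rsubmodule_sub[OF N] a_rcos_const by auto
  show "rsubmodule R M ?K"
    unfolding rsubmodule_iff
  proof (intro conjI ballI)
    show "\<zero>\<^bsub>M\<^esub> \<in> ?K" using subsetD[OF NK rsubmodule_zero[OF N]] .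
  next
    fix a r assume "a \<in> ?K" "r \<in> carrier R"
    then show "a \<bullet>\<^bsub>M\<^esub> r \<in> ?K"
      using Q.rsubmodule_ract[OF K, of "N +>\<^bsub>M\<^esub> a" r] by (simp add: rquot_ract[OF N] ract_closed)
  qed (auto simp: add Q.rsubmodule_add[OF K])
  show "K = (\<lambda>v. N +>\<^bsub>M\<^esub> v) ` ?K"
    using Q.rsubmodule_sub[OF K] by (auto simp: rquot_carrier)
qed

lemma coprime_rquot_iff:
  assumes N: "rsubmodule R M N"
  shows "coprime_rmodule R (rquot M N) \<longleftrightarrow> N \<noteq> carrier M \<and>
    (\<forall>K. rsubmodule R M K \<and> N \<subseteq> K \<and> K \<noteq> carrier M \<longrightarrow> colon R M K = colon R M N)"
    (is "_ \<longleftrightarrow> _ \<and> ?R")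
proof -
  interpret Q: right_module R "rquot M N" using right_module_rquot[OF N] .
  have "(\<forall>K. rsubmodule R (rquot M N) K \<and> K \<noteq> carrier (rquot M N) \<longrightarrow>
           colon R M N = colon R (rquot M N) K) \<longleftrightarrow> ?R" (is "?L \<longleftrightarrow> _")
  proof
    assume L: ?L
    show ?R
    proof (intro allI impI, elim conjE)
      fix K assume "rsubmodule R M K" "N \<subseteq> K" "K \<noteq> carrier M"
      then show "colon R M K = colon R M N"
        using L rsubmodule_colon_quotient[OF N, of K] by metis
    qed
  next
    assume R: ?R
    show ?L
    proof (intro allI impI, elim conjE)
      fix K assume "rsubmodule R (rquot M N) K" "K \<noteq> carrier (rquot M N)"
      then show "colon R M N = colon R (rquot M N) K"
        using R rsubmodule_preimage[OF N, of K] rsubmodule_colon_quotient[OF N] by metis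
    qed
  qed
  then show ?thesis
    by (simp add: Q.coprime_rmodule_iff rann_rquot[OF N] rquot_trivial_iff[OF N])
qed

lemma ideal_colon:
  assumes N: "rsubmodule R M N"
  shows "ideal (colon R M N) R"
proof (rule idealI[OF R.ring_axioms])
  show "subgroup (colon R M N) (add_monoid R)"
  proof (rule R.add.subgroupI)
    show "colon R M N \<noteq> {}"
      using rsubmodule_zero[OF N] by (auto simp: colon_def ract_zero intro!: exI[of _ "\<zero>\<^bsub>R\<^esub>"])
  qed (use N in \<open>auto simp: colon_def ract_minus ract_r_distr rsubmodule_minus rsubmodule_add\<close>)
qed (use N in \<open>auto simp: colon_def ract_assoc ract_closed rsubmodule_ract\<close>)

text \<open>Supplies the primeness that \<open>Att\<close> demands. For a product \<open>I J\<close>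
  inside the colon, coprimality compares \<open>N\<close> with the larger submodule of elements that
  \<open>J\<close> sends into \<open>N\<close>.\<close>

lemma prime_colon_of_coprime:
  assumes N: "rsubmodule R M N" and cop: "coprime_rmodule R (rquot M N)"
  shows "nc_prime_ideal R (colon R M N)"
proof -
  have NM: "N \<noteq> carrier M"
    using cop by (auto simp: coprime_rquot_iff[OF N])
  have *: "colon R M K = colon R M N" if "rsubmodule R M K" "N \<subseteq> K" "K \<noteq> carrier M" for K
    using cop that by (auto simp: coprime_rquot_iff[OF N])
  have "\<one>\<^bsub>R\<^esub> \<notin> colon R M N"
    using NM rsubmodule_sub[OF N] by (auto simp: colon_def ract_one)
  then have ne: "colon R M N \<noteq> carrier R" by auto
  have "I \<subseteq> colon R M N \<or> J \<subseteq> colon R M N"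
    if I: "ideal I R" and J: "ideal J R" and IJ: "I \<cdot>\<^bsub>R\<^esub> J \<subseteq> colon R M N" for I J
  proof -
    interpret I: ideal I R by fact
    interpret J: ideal J R by fact
    \<comment> \<open>Either all of \<open>M J\<close> lies in \<open>N\<close>, or \<open>M I\<close> lies in the proper submodule \<open>K\<close>.\<close>
    let ?K = "{v \<in> carrier M. \<forall>j\<in>J. v \<bullet>\<^bsub>M\<^esub> j \<in> N}"
    have K: "rsubmodule R M ?K"
      unfolding rsubmodule_iff
    proof (intro conjI ballI)
      fix a r assume "a \<in> ?K" "r \<in> carrier R"
      then show "a \<bullet>\<^bsub>M\<^esub> r \<in> ?K"
        using J.I_l_closed by (auto simp: ract_closed ract_assoc[symmetric])
    qed (auto simp: ract_l_distr zero_ract rsubmodule_add[OF N] rsubmodule_zero[OF N])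
    have NK: "N \<subseteq> ?K" using rsubmodule_sub[OF N] rsubmodule_ract[OF N] by auto
    show ?thesis
    proof (cases "?K = carrier M")
      case True
      then have "J \<subseteq> colon R M N" by (auto simp: colon_def)
      then show ?thesis ..
    next
      case False
      have "v \<bullet>\<^bsub>M\<^esub> i \<in> ?K" if "v \<in> carrier M" "i \<in> I" for v i
        using that IJ ideal_prod.prod[of i I _ J R]
        by (auto simp: ract_closed ract_assoc[symmetric] colon_def)
      then have "I \<subseteq> colon R M ?K" by (auto simp: colon_def)
      then show ?thesis using *[OF K NK False] by simp
    qed
  qed
  with ne ideal_colon[OF N] show ?thesis unfolding nc_prime_ideal_def by blast
qed

text \<open>The working form of \<open>Att\<close>: the correspondence of submodules removes the
  cosets, and \<open>prime_colon_of_coprime\<close> settles primeness in the backward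
  direction.\<close>

lemma Att_iff:
  "P \<in> Att R M \<longleftrightarrow> (\<exists>N. rsubmodule R M N \<and> N \<noteq> carrier M \<and> P = colon R M N \<and>
     (\<forall>K. rsubmodule R M K \<and> N \<subseteq> K \<and> K \<noteq> carrier M \<longrightarrow> colon R M K = P))"
    (is "_ \<longleftrightarrow> ?R")
proof
  assume "P \<in> Att R M"
  then obtain N where N: "rsubmodule R M N" and "coprime_rmodule R (rquot M N)"
    and "P = colon R M N"
    unfolding Att_def using rann_rquot by auto
  then show ?R unfolding coprime_rquot_iff[OF N] by blast
next
  assume ?R
  then obtain N where N: "rsubmodule R M N" and P: "P = colon R M N"
    and "N \<noteq> carrier M \<and> (\<forall>K. rsubmodule R M K \<and> N \<subseteq> K \<and> K \<noteq> carrier M \<longrightarrow> colon R M K = P)"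
    by blast
  then have "coprime_rmodule R (rquot M N)" unfolding coprime_rquot_iff[OF N] by blast
  with N prime_colon_of_coprime[OF N] show "P \<in> Att R M"
    unfolding Att_def P rann_rquot[OF N, symmetric] by blast
qed

text \<open>A simple quotient is coprime: the only proper submodule above a maximal \<open>N\<close>
  is \<open>N\<close> itself.\<close>

lemma maximal_rsubmodule_Att:
  assumes "maximal_rsubmodule R M N"
  shows "colon R M N \<in> Att R M"
  using assms unfolding Att_iff maximal_rsubmodule_def by blast

text \<open>Turns vanishing in a quotient into membership in \<open>N\<close>, so that the
  hypothesis on the quotients of \<open>M[x^-1]\<close> can be applied to elements.\<close>

lemma completely_compatible_iff:
  "completely_compatible R \<sigma> \<delta> M \<longleftrightarrow> (\<forall>N. rsubmodule R M N \<longrightarrow>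
     (\<forall>m\<in>carrier M. \<forall>r\<in>carrier R.
        (m \<bullet>\<^bsub>M\<^esub> r \<in> N \<longleftrightarrow> m \<bullet>\<^bsub>M\<^esub> \<sigma> r \<in> N) \<and> (m \<bullet>\<^bsub>M\<^esub> r \<in> N \<longrightarrow> m \<bullet>\<^bsub>M\<^esub> \<delta> r \<in> N)))"
  if "\<sigma> \<in> carrier R \<rightarrow> carrier R" "\<delta> \<in> carrier R \<rightarrow> carrier R"
proof -
  have zero: "\<zero>\<^bsub>rquot M N\<^esub> = N" for N by (simp add: rquot_def)
  have *: "m \<bullet>\<^bsub>M\<^esub> \<sigma> r \<in> carrier M" "m \<bullet>\<^bsub>M\<^esub> \<delta> r \<in> carrier M" "\<sigma> r \<in> carrier R" "\<delta> r \<in> carrier R"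
    if "m \<in> carrier M" "r \<in> carrier R" for m r
    using that \<open>\<sigma> \<in> _\<close> \<open>\<delta> \<in> _\<close> by (auto intro!: ract_closed)
  have "sigma_compatible R \<sigma> (rquot M N) \<and> delta_compatible R \<delta> (rquot M N) \<longleftrightarrow>
     (\<forall>m\<in>carrier M. \<forall>r\<in>carrier R.
        (m \<bullet>\<^bsub>M\<^esub> r \<in> N \<longleftrightarrow> m \<bullet>\<^bsub>M\<^esub> \<sigma> r \<in> N) \<and> (m \<bullet>\<^bsub>M\<^esub> r \<in> N \<longrightarrow> m \<bullet>\<^bsub>M\<^esub> \<delta> r \<in> N))"
    if N: "rsubmodule R M N" for N
    unfolding sigma_compatible_def delta_compatible_def rquot_carrier zero
    using * by (auto simp: rquot_ract[OF N] coset_eq_self_iff[OF N] ract_closed)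
  then show ?thesis unfolding completely_compatible_def by simp
qed

end

section \<open>The module of inverse polynomials over the coefficient ring\<close>

lemma up_iff: "f \<in> up M \<longleftrightarrow> (\<forall>k. f k \<in> carrier M) \<and> (\<exists>n. \<forall>k\<ge>n. f k = \<zero>\<^bsub>M\<^esub>)"
proof -
  have "(\<exists>n. bound \<zero>\<^bsub>M\<^esub> n f) \<longleftrightarrow> (\<exists>n. \<forall>k\<ge>n. f k = \<zero>\<^bsub>M\<^esub>)"
    unfolding bound_def by (metis Suc_le_lessD less_or_eq_imp_le)
  then show ?thesis by (auto simp: up_def Pi_def)
qed

lemma up_carrier: "f \<in> up M \<Longrightarrow> f k \<in> carrier M"
  by (simp add: up_iff)

lemma up_bounded:
  assumes "f \<in> up M"
  obtains n where "\<And>k. n \<le> k \<Longrightarrow> f k = \<zero>\<^bsub>M\<^esub>"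
  using assms by (auto simp: up_iff)

lemma up_support_finite:
  assumes "f \<in> up M"
  shows "finite {k. f k \<noteq> \<zero>\<^bsub>M\<^esub>}"
proof -
  obtain n where "\<And>k. n \<le> k \<Longrightarrow> f k = \<zero>\<^bsub>M\<^esub>" using up_bounded[OF assms] by blast
  then have "{k. f k \<noteq> \<zero>\<^bsub>M\<^esub>} \<subseteq> {..<n}" by (auto simp: not_le[symmetric])
  then show ?thesis by (rule finite_subset) simp
qed

lemma up_case_nat: "c \<in> carrier M \<Longrightarrow> g \<in> up M \<Longrightarrow> case_nat c g \<in> up M"
proof -
  assume c: "c \<in> carrier M" and g: "g \<in> up M"
  obtain n where "\<And>k. n \<le> k \<Longrightarrow> g k = \<zero>\<^bsub>M\<^esub>" using up_bounded[OF g] by blast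
  then have "\<forall>k\<ge>Suc n. case_nat c g k = \<zero>\<^bsub>M\<^esub>" by (auto split: nat.split)
  with c g show ?thesis unfolding up_iff by (auto split: nat.split)
qed

lemma up_shift: "f \<in> up M \<Longrightarrow> (\<lambda>k. f (Suc k)) \<in> up M"
  unfolding up_iff by (meson le_SucI)

lemma up_shift_funpow: "f \<in> up M \<Longrightarrow> (\<lambda>k. f (k + j)) \<in> up M"
  unfolding up_iff by (meson trans_le_add1)

lemma case_nat_shift: "case_nat (f 0) (\<lambda>k. f (Suc k)) = f"
  by (rule ext) (simp split: nat.split)

lemma up_zero: "abelian_group M \<Longrightarrow> (\<lambda>_. \<zero>\<^bsub>M\<^esub>) \<in> up M"
  by (simp add: up_iff abelian_group.axioms abelian_monoid.zero_closed)

lemma up_add: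
  assumes "abelian_group M" "f \<in> up M" "g \<in> up M"
  shows "(\<lambda>k. f k \<oplus>\<^bsub>M\<^esub> g k) \<in> up M"
proof -
  interpret abelian_group M by fact
  obtain m where m: "\<And>k. m \<le> k \<Longrightarrow> f k = \<zero>\<^bsub>M\<^esub>" using up_bounded[OF assms(2)] by blast
  obtain n where n: "\<And>k. n \<le> k \<Longrightarrow> g k = \<zero>\<^bsub>M\<^esub>" using up_bounded[OF assms(3)] by blast
  have "\<forall>k\<ge>max m n. f k \<oplus>\<^bsub>M\<^esub> g k = \<zero>\<^bsub>M\<^esub>" using m n by simp
  then show ?thesis using assms(2,3) unfolding up_iff by blast
qed

lemma up_minus:
  assumes "abelian_group M" "f \<in> up M"
  shows "(\<lambda>k. \<ominus>\<^bsub>M\<^esub> f k) \<in> up M"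
proof -
  interpret abelian_group M by fact
  obtain m where m: "\<And>k. m \<le> k \<Longrightarrow> f k = \<zero>\<^bsub>M\<^esub>" using up_bounded[OF assms(2)] by blast
  have "\<forall>k\<ge>m. \<ominus>\<^bsub>M\<^esub> f k = \<zero>\<^bsub>M\<^esub>" using m by simp
  then show ?thesis using assms(2) unfolding up_iff by auto
qed

text \<open>\<open>case_nat c g\<close> stands for \<open>c + g x^-1\<close>, so the induction
  strips off constant terms. The rule also serves for coefficient sequences of \<open>A\<close>,
  where \<open>case_nat r c\<close> stands for \<open>r + c x\<close>.\<close>

lemma up_induct [consumes 1, case_names zero cons]:
  assumes f: "f \<in> up M"
    and zero: "P (\<lambda>_. \<zero>\<^bsub>M\<^esub>)"
    and cons: "\<And>c g. c \<in> carrier M \<Longrightarrow> g \<in> up M \<Longrightarrow> P g \<Longrightarrow> P (case_nat c g)"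
  shows "P f"
proof -
  obtain n where "\<forall>k\<ge>n. f k = \<zero>\<^bsub>M\<^esub>" using f by (auto simp: up_iff)
  then show ?thesis using f
  proof (induction n arbitrary: f)
    case 0
    then have "f = (\<lambda>_. \<zero>\<^bsub>M\<^esub>)" by auto
    with zero show ?case by simp
  next
    case (Suc n)
    have "P (\<lambda>k. f (Suc k))" by (rule Suc.IH) (use Suc.prems up_shift in auto)
    then have "P (case_nat (f 0) (\<lambda>k. f (Suc k)))"
      by (intro cons up_carrier[OF Suc.prems(2)] up_shift[OF Suc.prems(2)])
    then show ?case unfolding case_nat_shift .
  qed
qed

section \<open>Words in two letters and the sums over them\<close>

abbreviation words :: "nat \<Rightarrow> nat \<Rightarrow> bool list set" where
  "words j i \<equiv> {w. length w = j \<and> count_list w True = i}"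

lemma finite_words: "finite (words j i)"
  by (rule finite_subset[OF _ finite_lists_length_eq[of UNIV j]]) auto

lemma words_0: "words 0 i = (if i = 0 then {[]} else {})"
  by auto

text \<open>Words are split at their last letter, which \<open>foldr\<close> applies first. The
  resulting recursion replaces \<open>r\<close> by \<open>\<sigma>' r\<close> or
  \<open>\<delta>' r\<close>, in step with
  \<open>m x^-1 r = m \<sigma>'(r) x^-1 + m \<delta>'(r)\<close>.\<close>

lemma words_Suc_Suc:
  "words (Suc j) (Suc i) = (\<lambda>w. w @ [True]) ` words j i \<union> (\<lambda>w. w @ [False]) ` words j (Suc i)"
proof -
  have "w \<in> (\<lambda>w. w @ [True]) ` words j i \<union> (\<lambda>w. w @ [False]) ` words j (Suc i)"
    if "w \<in> words (Suc j) (Suc i)" for w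
    using that by (cases w rule: rev_cases) (auto simp: image_iff split: if_splits)
  then show ?thesis by auto
qed

lemma words_Suc_0: "words (Suc j) 0 = (\<lambda>w. w @ [False]) ` words j 0"
proof -
  have "w \<in> (\<lambda>w. w @ [False]) ` words j 0" if "w \<in> words (Suc j) 0" for w
    using that by (cases w rule: rev_cases) (auto simp: image_iff split: if_splits)
  then show ?thesis by auto
qed

text \<open>The second product rule \<open>twist\<close> is not a property of skew derivations; it is forced by the
  associativity of the skew Ore polynomial ring. It is what makes \<open>\<delta>'\<close> a \<open>\<sigma>'\<close>-derivation.\<close>

locale inverse_polynomials = right_module R M
  for R (structure) and M :: "('a, 'b, 'c) rmodule_scheme" (structure) +
  fixes \<sigma> \<delta> :: "'a \<Rightarrow> 'a"
  assumes iso: "\<sigma> \<in> ring_iso R R"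
    and derivation: "skew_derivation R \<sigma> \<delta>"
    and twist: "\<lbrakk>r \<in> carrier R; s \<in> carrier R\<rbrakk> \<Longrightarrow>
      \<delta> (r \<otimes>\<^bsub>R\<^esub> s) = r \<otimes>\<^bsub>R\<^esub> \<delta> s \<oplus>\<^bsub>R\<^esub> \<delta> r \<otimes>\<^bsub>R\<^esub> \<sigma> s"
begin

abbreviation sinv ("\<sigma>''") where "\<sigma>' \<equiv> sigma_inv R \<sigma>"
abbreviation dinv ("\<delta>''") where "\<delta>' \<equiv> delta_inv R \<sigma> \<delta>"
abbreviation ws where "ws \<equiv> word_sum R \<sigma> \<delta>"
abbreviation act where "act \<equiv> inv_poly_ract R \<sigma> \<delta> M"
abbreviation V where "V \<equiv> inv_poly_R R \<sigma> \<delta> M"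

lemma sigma_closed [simp, intro]: "r \<in> carrier R \<Longrightarrow> \<sigma> r \<in> carrier R"
  using iso ring_hom_closed by (fastforce simp: ring_iso_def)

lemma sigma_Pi: "\<sigma> \<in> carrier R \<rightarrow> carrier R" by auto

lemma sigma_bij: "bij_betw \<sigma> (carrier R) (carrier R)"
  using iso by (simp add: ring_iso_def)

lemma sigma_inj: "inj_on \<sigma> (carrier R)"
  using sigma_bij by (rule bij_betw_imp_inj_on)

lemma sigma_add: "r \<in> carrier R \<Longrightarrow> s \<in> carrier R \<Longrightarrow> \<sigma> (r \<oplus>\<^bsub>R\<^esub> s) = \<sigma> r \<oplus>\<^bsub>R\<^esub> \<sigma> s"
  and sigma_mult: "r \<in> carrier R \<Longrightarrow> s \<in> carrier R \<Longrightarrow> \<sigma> (r \<otimes>\<^bsub>R\<^esub> s) = \<sigma> r \<otimes>\<^bsub>R\<^esub> \<sigma> s"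
  and sigma_one: "\<sigma> \<one>\<^bsub>R\<^esub> = \<one>\<^bsub>R\<^esub>"
  using iso by (auto simp: ring_iso_def ring_hom_def)

lemma sinv_closed [simp, intro]: "r \<in> carrier R \<Longrightarrow> \<sigma>' r \<in> carrier R"
  and sigma_sinv [simp]: "r \<in> carrier R \<Longrightarrow> \<sigma> (\<sigma>' r) = r"
  and sinv_sigma [simp]: "r \<in> carrier R \<Longrightarrow> \<sigma>' (\<sigma> r) = r"
proof -
  have *: "bij_betw \<sigma>' (carrier R) (carrier R)"
    unfolding sigma_inv_def by (rule bij_betw_inv_into[OF sigma_bij])
  show "r \<in> carrier R \<Longrightarrow> \<sigma>' r \<in> carrier R" using * by (auto dest: bij_betwE)
  show "r \<in> carrier R \<Longrightarrow> \<sigma> (\<sigma>' r) = r"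
    unfolding sigma_inv_def by (rule bij_betw_inv_into_right[OF sigma_bij])
  show "r \<in> carrier R \<Longrightarrow> \<sigma>' (\<sigma> r) = r"
    unfolding sigma_inv_def by (rule bij_betw_inv_into_left[OF sigma_bij])
qed

lemma sinv_add: "r \<in> carrier R \<Longrightarrow> s \<in> carrier R \<Longrightarrow> \<sigma>' (r \<oplus>\<^bsub>R\<^esub> s) = \<sigma>' r \<oplus>\<^bsub>R\<^esub> \<sigma>' s"
  by (rule inj_onD[OF sigma_inj]) (auto simp: sigma_add)

lemma sinv_mult: "r \<in> carrier R \<Longrightarrow> s \<in> carrier R \<Longrightarrow> \<sigma>' (r \<otimes>\<^bsub>R\<^esub> s) = \<sigma>' r \<otimes>\<^bsub>R\<^esub> \<sigma>' s"
  by (rule inj_onD[OF sigma_inj]) (auto simp: sigma_mult)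

lemma sinv_one: "\<sigma>' \<one>\<^bsub>R\<^esub> = \<one>\<^bsub>R\<^esub>"
  by (rule inj_onD[OF sigma_inj]) (auto simp: sigma_one)

lemma delta_closed [simp, intro]: "r \<in> carrier R \<Longrightarrow> \<delta> r \<in> carrier R"
  using derivation by (auto simp: skew_derivation_def)

lemma delta_Pi: "\<delta> \<in> carrier R \<rightarrow> carrier R" by auto

lemma delta_add: "r \<in> carrier R \<Longrightarrow> s \<in> carrier R \<Longrightarrow> \<delta> (r \<oplus>\<^bsub>R\<^esub> s) = \<delta> r \<oplus>\<^bsub>R\<^esub> \<delta> s"
  using derivation by (auto simp: skew_derivation_def)

lemma delta_one: "\<delta> \<one>\<^bsub>R\<^esub> = \<zero>\<^bsub>R\<^esub>"
  using twist[of "\<one>\<^bsub>R\<^esub>" "\<one>\<^bsub>R\<^esub>"] by (simp add: sigma_one R.add.r_cancel_one)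

lemma dinv_closed [simp, intro]: "r \<in> carrier R \<Longrightarrow> \<delta>' r \<in> carrier R"
  by (simp add: delta_inv_def)

lemma dinv_add: "r \<in> carrier R \<Longrightarrow> s \<in> carrier R \<Longrightarrow> \<delta>' (r \<oplus>\<^bsub>R\<^esub> s) = \<delta>' r \<oplus>\<^bsub>R\<^esub> \<delta>' s"
  by (simp add: delta_inv_def sinv_add delta_add R.minus_add)

lemma dinv_mult:
  "r \<in> carrier R \<Longrightarrow> s \<in> carrier R \<Longrightarrow> \<delta>' (r \<otimes>\<^bsub>R\<^esub> s) = \<sigma>' r \<otimes>\<^bsub>R\<^esub> \<delta>' s \<oplus>\<^bsub>R\<^esub> \<delta>' r \<otimes>\<^bsub>R\<^esub> s"
  by (simp add: delta_inv_def sinv_mult twist R.minus_add R.l_minus R.r_minus)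

lemma dinv_one: "\<delta>' \<one>\<^bsub>R\<^esub> = \<zero>\<^bsub>R\<^esub>"
  by (simp add: delta_inv_def sinv_one delta_one)

lemma dinv_sigma: "r \<in> carrier R \<Longrightarrow> \<delta>' (\<sigma> r) = \<ominus>\<^bsub>R\<^esub> \<delta> r"
  by (simp add: delta_inv_def)

lemma word_closed: "r \<in> carrier R \<Longrightarrow> foldr (\<lambda>b. if b then \<sigma>' else \<delta>') w r \<in> carrier R"
  by (induction w) auto

lemma ws_closed [simp, intro]: "r \<in> carrier R \<Longrightarrow> ws j i r \<in> carrier R"
  unfolding word_sum_def by (rule R.finsum_closed) (auto intro: word_closed)

lemma ws_0: "r \<in> carrier R \<Longrightarrow> ws 0 i r = (if i = 0 then r else \<zero>\<^bsub>R\<^esub>)"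
  unfolding word_sum_def words_0 by simp

lemma ws_append:
  "r \<in> carrier R \<Longrightarrow> (\<Oplus>\<^bsub>R\<^esub>w\<in>(\<lambda>w. w @ [b]) ` words j i. foldr (\<lambda>b. if b then \<sigma>' else \<delta>') w r) =
     ws j i (if b then \<sigma>' r else \<delta>' r)"
  unfolding word_sum_def
  by (subst R.finsum_reindex) (auto simp: inj_on_def word_closed)

lemma ws_Suc_0: "r \<in> carrier R \<Longrightarrow> ws (Suc j) 0 r = ws j 0 (\<delta>' r)"
  using ws_append[of r False j 0] by (simp add: word_sum_def[of _ _ _ "Suc j"] words_Suc_0)

lemma ws_Suc_Suc:
  assumes r: "r \<in> carrier R"
  shows "ws (Suc j) (Suc i) r = ws j i (\<sigma>' r) \<oplus>\<^bsub>R\<^esub> ws j (Suc i) (\<delta>' r)"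
proof -
  have "ws (Suc j) (Suc i) r =
      (\<Oplus>\<^bsub>R\<^esub>w\<in>(\<lambda>w. w @ [True]) ` words j i \<union> (\<lambda>w. w @ [False]) ` words j (Suc i).
        foldr (\<lambda>b. if b then \<sigma>' else \<delta>') w r)"
    by (simp only: word_sum_def words_Suc_Suc)
  also have "\<dots> = (\<Oplus>\<^bsub>R\<^esub>w\<in>(\<lambda>w. w @ [True]) ` words j i. foldr (\<lambda>b. if b then \<sigma>' else \<delta>') w r) \<oplus>\<^bsub>R\<^esub>
      (\<Oplus>\<^bsub>R\<^esub>w\<in>(\<lambda>w. w @ [False]) ` words j (Suc i). foldr (\<lambda>b. if b then \<sigma>' else \<delta>') w r)"
    by (rule R.finsum_Un_disjoint)
      (auto intro!: word_closed r finite_imageI finite_words simp del: foldr_append)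
  finally show ?thesis by (simp only: ws_append[OF r] if_True if_False)
qed

text \<open>The index set in \<open>inv_poly_ract_def\<close> depends on \<open>f\<close> and
  \<open>i\<close>. Trading it for any finite set around the support lets sums for different
  polynomials be combined; indices below \<open>i\<close> do no harm once their word sums vanish, as
  \<open>ws_above\<close> shows.\<close>

lemma act_eq:
  assumes f: "f \<in> up M" and r: "r \<in> carrier R"
    and D: "finite D" "\<And>k. k \<notin> D \<Longrightarrow> f k = \<zero>\<^bsub>M\<^esub>"
    and D': "\<And>k. k \<in> D \<Longrightarrow> k < i \<Longrightarrow> ws k i r = \<zero>\<^bsub>R\<^esub>"
  shows "act f r i = (\<Oplus>\<^bsub>M\<^esub>k\<in>D. f k \<bullet>\<^bsub>M\<^esub> ws k i r)"
  unfolding inv_poly_ract_def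
proof (rule M.add.finprod_mono_neutral_cong_left[OF D(1)])
  show "{k. i \<le> k \<and> f k \<noteq> \<zero>\<^bsub>M\<^esub>} \<subseteq> D" using D(2) by blast
  show "f k \<bullet>\<^bsub>M\<^esub> ws k i r = \<zero>\<^bsub>M\<^esub>" if "k \<in> D - {k. i \<le> k \<and> f k \<noteq> \<zero>\<^bsub>M\<^esub>}" for k
    using that D' up_carrier[OF f, of k] r by (auto simp: zero_ract ract_zero not_le)
qed (use f r in \<open>auto intro!: ract_closed up_carrier[OF f]\<close>)

lemma ws_above: "r \<in> carrier R \<Longrightarrow> k < i \<Longrightarrow> ws k i r = \<zero>\<^bsub>R\<^esub>"
proof (induction k arbitrary: r i)
  case 0 then show ?case by (simp add: ws_0)
next
  case (Suc k) then show ?case by (cases i) (simp_all add: ws_Suc_Suc)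
qed

section \<open>The action of \<open>R\<close> on inverse polynomials\<close>

lemma act_closed':
  assumes f: "f \<in> up M" and r: "r \<in> carrier R"
  shows "act f r i \<in> carrier M"
  unfolding inv_poly_ract_def using f r
  by (intro M.finsum_closed) (auto intro!: ract_closed up_carrier[OF f])

lemma act_above:
  assumes f: "f \<in> up M" and r: "r \<in> carrier R" and n: "\<And>k. n \<le> k \<Longrightarrow> f k = \<zero>\<^bsub>M\<^esub>" and "n \<le> i"
  shows "act f r i = \<zero>\<^bsub>M\<^esub>"
proof -
  have *: "{k. i \<le> k \<and> f k \<noteq> \<zero>\<^bsub>M\<^esub>} = {}" using n \<open>n \<le> i\<close> by auto
  show ?thesis unfolding inv_poly_ract_def * by simp
qed

lemma act_closed: "f \<in> up M \<Longrightarrow> r \<in> carrier R \<Longrightarrow> act f r \<in> up M"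
  using act_above act_closed' unfolding up_iff[of "act f r"] by (metis up_bounded)

lemma act_zero_left: "act (\<lambda>_. \<zero>\<^bsub>M\<^esub>) r = (\<lambda>_. \<zero>\<^bsub>M\<^esub>)"
  by (rule ext) (simp add: inv_poly_ract_def)

text \<open>The coefficients of \<open>(c + g x^-1) r = c r + (g \<sigma>'(r)) x^-1 + g
  \<delta>'(r)\<close>. Most later facts about the action follow from this recursion by
  \<open>up_induct\<close>, without word sums.\<close>

lemma
  assumes c: "c \<in> carrier M" and g: "g \<in> up M" and r: "r \<in> carrier R"
  shows act_cons_0: "act (case_nat c g) r 0 = c \<bullet>\<^bsub>M\<^esub> r \<oplus>\<^bsub>M\<^esub> act g (\<delta>' r) 0"
    and act_cons_Suc: "act (case_nat c g) r (Suc i) = act g (\<sigma>' r) i \<oplus>\<^bsub>M\<^esub> act g (\<delta>' r) (Suc i)"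
proof -
  obtain n where n: "\<And>k. n \<le> k \<Longrightarrow> g k = \<zero>\<^bsub>M\<^esub>" using up_bounded[OF g] by blast
  have gc: "g k \<in> carrier M" for k using g by (rule up_carrier)
  have eq: "act g s i = (\<Oplus>\<^bsub>M\<^esub>k\<in>{..n}. g k \<bullet>\<^bsub>M\<^esub> ws k i s)" if "s \<in> carrier R" for s i
    using n that by (intro act_eq[OF g]) (auto simp: ws_above)
  have "act (case_nat c g) r i = (\<Oplus>\<^bsub>M\<^esub>k\<in>{..Suc n}. case_nat c g k \<bullet>\<^bsub>M\<^esub> ws k i r)" for i
    using n by (intro act_eq[OF up_case_nat[OF c g] r]) (auto simp: ws_above r split: nat.split)
  \<comment> \<open>Splitting off index \<open>0\<close> isolates the constant term; the words that
    remain have length \<open>Suc k\<close>, as the recursion for word sums requires.\<close>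
  also have "\<dots> i = (\<Oplus>\<^bsub>M\<^esub>k\<in>{..n}. g k \<bullet>\<^bsub>M\<^esub> ws (Suc k) i r) \<oplus>\<^bsub>M\<^esub> c \<bullet>\<^bsub>M\<^esub> ws 0 i r" for i
    using c gc r by (subst M.finsum_Suc2) (auto intro!: ract_closed split: nat.split)
  finally have *: "act (case_nat c g) r i =
      (\<Oplus>\<^bsub>M\<^esub>k\<in>{..n}. g k \<bullet>\<^bsub>M\<^esub> ws (Suc k) i r) \<oplus>\<^bsub>M\<^esub> c \<bullet>\<^bsub>M\<^esub> ws 0 i r" for i .
  have "(\<Oplus>\<^bsub>M\<^esub>k\<in>{..n}. g k \<bullet>\<^bsub>M\<^esub> ws (Suc k) 0 r) = act g (\<delta>' r) 0"
    using r by (simp add: eq ws_Suc_0)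
  moreover have "act g (\<delta>' r) 0 \<in> carrier M" using g r by (simp add: act_closed')
  ultimately show "act (case_nat c g) r 0 = c \<bullet>\<^bsub>M\<^esub> r \<oplus>\<^bsub>M\<^esub> act g (\<delta>' r) 0"
    using c r by (simp add: * ws_0 ract_closed M.a_comm)
  have "(\<Oplus>\<^bsub>M\<^esub>k\<in>{..n}. g k \<bullet>\<^bsub>M\<^esub> ws (Suc k) (Suc i) r) =
      (\<Oplus>\<^bsub>M\<^esub>k\<in>{..n}. g k \<bullet>\<^bsub>M\<^esub> ws k i (\<sigma>' r) \<oplus>\<^bsub>M\<^esub> g k \<bullet>\<^bsub>M\<^esub> ws k (Suc i) (\<delta>' r))"
    using r gc by (intro M.finsum_cong') (auto simp: ws_Suc_Suc ract_r_distr intro!: ract_closed)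
  also have "\<dots> = act g (\<sigma>' r) i \<oplus>\<^bsub>M\<^esub> act g (\<delta>' r) (Suc i)"
    using r gc by (subst M.finsum_addf) (auto simp: eq intro!: ract_closed)
  finally show "act (case_nat c g) r (Suc i) = act g (\<sigma>' r) i \<oplus>\<^bsub>M\<^esub> act g (\<delta>' r) (Suc i)"
    using c g r by (simp add: * ws_0 ract_zero act_closed')
qed

lemma act_cons:
  assumes "c \<in> carrier M" "g \<in> up M" "r \<in> carrier R"
  shows "act (case_nat c g) r =
    (\<lambda>i. case_nat (c \<bullet>\<^bsub>M\<^esub> r) (act g (\<sigma>' r)) i \<oplus>\<^bsub>M\<^esub> act g (\<delta>' r) i)"
  by (rule ext) (simp add: act_cons_0[OF assms] act_cons_Suc[OF assms] split: nat.split)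

lemma act_add_left:
  assumes f: "f \<in> up M" and g: "g \<in> up M" and r: "r \<in> carrier R"
  shows "act (\<lambda>k. f k \<oplus>\<^bsub>M\<^esub> g k) r = (\<lambda>k. act f r k \<oplus>\<^bsub>M\<^esub> act g r k)"
proof
  fix i
  obtain n where n: "\<And>k. n \<le> k \<Longrightarrow> f k = \<zero>\<^bsub>M\<^esub>" using up_bounded[OF f] by blast
  obtain m where m: "\<And>k. m \<le> k \<Longrightarrow> g k = \<zero>\<^bsub>M\<^esub>" using up_bounded[OF g] by blast
  let ?D = "{..max m n}"
  note [simp] = up_carrier[OF f] up_carrier[OF g]
  have eq: "act h r i = (\<Oplus>\<^bsub>M\<^esub>k\<in>?D. h k \<bullet>\<^bsub>M\<^esub> ws k i r)"
    if "h \<in> up M" "\<And>k. k \<notin> ?D \<Longrightarrow> h k = \<zero>\<^bsub>M\<^esub>" for h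
    using that r by (intro act_eq) (auto simp: ws_above)
  have "act (\<lambda>k. f k \<oplus>\<^bsub>M\<^esub> g k) r i = (\<Oplus>\<^bsub>M\<^esub>k\<in>?D. (f k \<oplus>\<^bsub>M\<^esub> g k) \<bullet>\<^bsub>M\<^esub> ws k i r)"
    using n m up_add[OF M.abelian_group_axioms f g] by (intro eq) auto
  also have "\<dots> = (\<Oplus>\<^bsub>M\<^esub>k\<in>?D. f k \<bullet>\<^bsub>M\<^esub> ws k i r \<oplus>\<^bsub>M\<^esub> g k \<bullet>\<^bsub>M\<^esub> ws k i r)"
    using r by (simp add: ract_l_distr)
  also have "\<dots> = act f r i \<oplus>\<^bsub>M\<^esub> act g r i"
  proof -
    have "act f r i = (\<Oplus>\<^bsub>M\<^esub>k\<in>?D. f k \<bullet>\<^bsub>M\<^esub> ws k i r)" using n by (intro eq f) auto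
    moreover have "act g r i = (\<Oplus>\<^bsub>M\<^esub>k\<in>?D. g k \<bullet>\<^bsub>M\<^esub> ws k i r)" using m by (intro eq g) auto
    ultimately show ?thesis using r by (subst M.finsum_addf) (auto intro!: ract_closed)
  qed
  finally show "act (\<lambda>k. f k \<oplus>\<^bsub>M\<^esub> g k) r i = act f r i \<oplus>\<^bsub>M\<^esub> act g r i" .
qed

lemma act_add_right:
  assumes "f \<in> up M" "r \<in> carrier R" "s \<in> carrier R"
  shows "act f (r \<oplus>\<^bsub>R\<^esub> s) = (\<lambda>k. act f r k \<oplus>\<^bsub>M\<^esub> act f s k)"
  using assms
proof (induction arbitrary: r s rule: up_induct)
  case zero
  then show ?case by (simp add: act_zero_left)
next
  case (cons c g)
  then show ?case
    by (auto simp: fun_eq_iff act_cons dinv_add sinv_add ract_r_distr act_closed' ract_closed M.a_ac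
        split: nat.split)
qed

lemma act_zero_right:
  assumes f: "f \<in> up M"
  shows "act f \<zero>\<^bsub>R\<^esub> = (\<lambda>_. \<zero>\<^bsub>M\<^esub>)"
proof
  fix k
  have "act f \<zero>\<^bsub>R\<^esub> k \<oplus>\<^bsub>M\<^esub> act f \<zero>\<^bsub>R\<^esub> k = act f \<zero>\<^bsub>R\<^esub> k"
    using fun_cong[OF act_add_right[OF f, of "\<zero>\<^bsub>R\<^esub>" "\<zero>\<^bsub>R\<^esub>"], of k] by simp
  then show "act f \<zero>\<^bsub>R\<^esub> k = \<zero>\<^bsub>M\<^esub>" using f by (simp add: act_closed' M.add.r_cancel_one)
qed

text \<open>The induction treats all \<open>r\<close> and \<open>s\<close> at once, because the
  recursion passes to their images under \<open>\<sigma>'\<close> and \<open>\<delta>'\<close>. The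
  terms match because \<open>\<delta>'\<close> is a \<open>\<sigma>'\<close>-derivation
  (\<open>dinv_mult\<close>).\<close>

lemma act_assoc:
  assumes "f \<in> up M" "r \<in> carrier R" "s \<in> carrier R"
  shows "act f (r \<otimes>\<^bsub>R\<^esub> s) = act (act f r) s"
  using assms
proof (induction arbitrary: r s rule: up_induct)
  case zero
  then show ?case by (simp add: act_zero_left)
next
  case (cons c g)
  then have "act (act (case_nat c g) r) s =
      (\<lambda>k. act (case_nat (c \<bullet>\<^bsub>M\<^esub> r) (act g (\<sigma>' r))) s k \<oplus>\<^bsub>M\<^esub> act (act g (\<delta>' r)) s k)"
    by (subst act_cons) (auto intro!: act_add_left up_case_nat act_closed ract_closed)
  moreover have "act (act g r) s k \<in> carrier M" if "r \<in> carrier R" "s \<in> carrier R" for r s k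
    using that cons by (intro act_closed' act_closed)
  ultimately show ?case
    using cons
    by (auto simp: fun_eq_iff act_cons dinv_mult sinv_mult ract_assoc act_closed ract_closed
        act_add_right M.a_ac split: nat.split)
qed

lemma act_one: "f \<in> up M \<Longrightarrow> act f \<one>\<^bsub>R\<^esub> = f"
proof (induction rule: up_induct)
  case zero
  then show ?case by (simp add: act_zero_left)
next
  case (cons c g)
  then show ?case
    by (auto simp: fun_eq_iff act_cons sinv_one dinv_one act_zero_right ract_one up_carrier
        split: nat.split)
qed

lemma V_simps [simp]:
  "carrier V = up M" "\<zero>\<^bsub>V\<^esub> = (\<lambda>_. \<zero>\<^bsub>M\<^esub>)" "f \<oplus>\<^bsub>V\<^esub> g = (\<lambda>i. f i \<oplus>\<^bsub>M\<^esub> g i)" "f \<bullet>\<^bsub>V\<^esub> r = act f r"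
  by (simp_all add: inv_poly_R_def)

lemma abelian_group_V: "abelian_group V"
proof (rule abelian_groupI, goal_cases)
  case (6 f)
  then have "(\<lambda>k. \<ominus>\<^bsub>M\<^esub> f k) \<oplus>\<^bsub>V\<^esub> f = \<zero>\<^bsub>V\<^esub>"
    by (simp add: up_carrier M.l_neg)
  with 6 show ?case using up_minus[OF M.abelian_group_axioms] by force
qed (auto simp: up_zero up_add M.abelian_group_axioms fun_eq_iff M.a_ac up_carrier)

lemma right_module_V: "right_module R V"
  by (intro right_module.intro right_module_axioms.intro R.ring_axioms abelian_group_V)
    (auto simp: act_closed act_add_left act_add_right act_assoc act_one)

sublocale V: right_module R V
  by (rule right_module_V)

lemma V_minus: "f \<in> up M \<Longrightarrow> \<ominus>\<^bsub>V\<^esub> f = (\<lambda>k. \<ominus>\<^bsub>M\<^esub> f k)"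
  by (rule V.M.minus_equality)
    (auto simp: up_minus M.abelian_group_axioms up_carrier M.l_neg)

lemma act_minus_right:
  "f \<in> up M \<Longrightarrow> r \<in> carrier R \<Longrightarrow> act f (\<ominus>\<^bsub>R\<^esub> r) = (\<lambda>k. \<ominus>\<^bsub>M\<^esub> act f r k)"
  using V.ract_minus[of f r] by (simp add: V_minus act_closed)

section \<open>Shifts and top coefficients\<close>

lemma shift_act:
  assumes "f \<in> up M" "r \<in> carrier R"
  shows "act f r (Suc k) = act (\<lambda>k. f (Suc k)) (\<sigma>' r) k \<oplus>\<^bsub>M\<^esub> act (\<lambda>k. f (Suc k)) (\<delta>' r) (Suc k)"
  using act_cons_Suc[of "f 0" "\<lambda>k. f (Suc k)" r k] assms
  by (simp add: case_nat_shift up_shift up_carrier)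

text \<open>The commutation rule \<open>x r = \<sigma>(r) x + x \<delta>(r) x\<close> read in
  \<open>M[x^-1]\<close>, where \<open>x\<close> acts as the shift. It is \<open>shift_act\<close>
  at \<open>\<sigma> r\<close>, with the term for
  \<open>\<delta>' (\<sigma> r) = -\<delta> r\<close> moved to the other side.\<close>

lemma act_shift:
  assumes "f \<in> up M" "r \<in> carrier R"
  shows "act (\<lambda>k. f (Suc k)) r k =
    act f (\<sigma> r) (Suc k) \<oplus>\<^bsub>M\<^esub> act (\<lambda>k. f (Suc k)) (\<delta> r) (Suc k)"
  using assms shift_act[of f "\<sigma> r" k]
  by (simp add: dinv_sigma act_minus_right up_shift act_closed' M.a_assoc M.l_neg)

lemma sinv_funpow_closed: "r \<in> carrier R \<Longrightarrow> (\<sigma>' ^^ k) r \<in> carrier R"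
  by (induction k) auto

text \<open>Every letter \<open>\<delta>'\<close> lowers the degree, so only the word made of
  letters \<open>\<sigma>'\<close> alone reaches the top degree \<open>k\<close>.\<close>

lemma act_top:
  assumes "f \<in> up M" "r \<in> carrier R" "\<And>i. k < i \<Longrightarrow> f i = \<zero>\<^bsub>M\<^esub>"
  shows "act f r k = f k \<bullet>\<^bsub>M\<^esub> (\<sigma>' ^^ k) r"
  using assms
proof (induction k arbitrary: f r)
  case 0
  then have "(\<lambda>k. f (Suc k)) = (\<lambda>_. \<zero>\<^bsub>M\<^esub>)" by auto
  then show ?case
    using act_cons_0[of "f 0" "\<lambda>k. f (Suc k)" r] 0
      case_nat_shift[of f] up_zero[OF M.abelian_group_axioms]
    by (simp add: up_carrier act_zero_left ract_closed)
next
  case (Suc k)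
  have "act (\<lambda>k. f (Suc k)) (\<delta>' r) (Suc k) = \<zero>\<^bsub>M\<^esub>"
    using Suc.prems by (intro act_above[of _ _ "Suc k"] up_shift) auto
  moreover have "act (\<lambda>k. f (Suc k)) (\<sigma>' r) k = f (Suc k) \<bullet>\<^bsub>M\<^esub> (\<sigma>' ^^ k) (\<sigma>' r)"
    using Suc.prems by (intro Suc.IH up_shift) auto
  ultimately show ?case
    using Suc.prems shift_act[of f r k]
    by (simp add: up_carrier ract_closed funpow_swap1 sinv_funpow_closed)
qed

lemma sigma_funpow_closed: "r \<in> carrier R \<Longrightarrow> (\<sigma> ^^ k) r \<in> carrier R"
  by (induction k) auto

lemma sinv_sigma_funpow: "r \<in> carrier R \<Longrightarrow> (\<sigma>' ^^ k) ((\<sigma> ^^ k) r) = r"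
  by (induction k) (simp_all add: funpow_swap1[of \<sigma>'] sigma_funpow_closed)

end

section \<open>Coefficients in a skew Ore polynomial ring\<close>

locale skew_ore = R?: ring R + A?: ring A
  for R :: "('r, 'u) ring_scheme" (structure) and A :: "('a, 'v) ring_scheme" (structure) +
  fixes \<sigma> \<delta> :: "'r \<Rightarrow> 'r" and \<iota> :: "'r \<Rightarrow> 'a" and x :: 'a
  assumes sigma_iso: "\<sigma> \<in> ring_iso R R"
    and skew_der: "skew_derivation R \<sigma> \<delta>"
    and skew_ore_ring: "skew_ore_ring R \<sigma> \<delta> A \<iota> x"
begin

abbreviation ev where "ev \<equiv> skew_eval R A \<iota> x"
abbreviation coeffs where "coeffs \<equiv> skew_coeffs R A \<iota> x"

lemma iota_hom: "\<iota> \<in> ring_hom R A"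
  using skew_ore_ring by (simp add: skew_ore_ring_def)

lemma iota_closed [simp, intro]: "r \<in> carrier R \<Longrightarrow> \<iota> r \<in> carrier A"
  and iota_add: "r \<in> carrier R \<Longrightarrow> s \<in> carrier R \<Longrightarrow> \<iota> (r \<oplus>\<^bsub>R\<^esub> s) = \<iota> r \<oplus>\<^bsub>A\<^esub> \<iota> s"
  and iota_mult: "r \<in> carrier R \<Longrightarrow> s \<in> carrier R \<Longrightarrow> \<iota> (r \<otimes>\<^bsub>R\<^esub> s) = \<iota> r \<otimes>\<^bsub>A\<^esub> \<iota> s"
  and iota_one: "\<iota> \<one>\<^bsub>R\<^esub> = \<one>\<^bsub>A\<^esub>"
  using iota_hom by (auto simp: ring_hom_def)

lemma iota_zero: "\<iota> \<zero>\<^bsub>R\<^esub> = \<zero>\<^bsub>A\<^esub>"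
  using ring_hom_zero[OF iota_hom R.ring_axioms A.ring_axioms] .

lemma x_closed [simp, intro]: "x \<in> carrier A"
  using skew_ore_ring by (simp add: skew_ore_ring_def)

lemma x_comm: "r \<in> carrier R \<Longrightarrow>
    x \<otimes>\<^bsub>A\<^esub> \<iota> r = \<iota> (\<sigma> r) \<otimes>\<^bsub>A\<^esub> x \<oplus>\<^bsub>A\<^esub> x \<otimes>\<^bsub>A\<^esub> \<iota> (\<delta> r) \<otimes>\<^bsub>A\<^esub> x"
  using skew_ore_ring by (simp add: skew_ore_ring_def)

lemma ev_unique: "a \<in> carrier A \<Longrightarrow> \<exists>!c. c \<in> up R \<and> a = ev c"
  using skew_ore_ring by (simp add: skew_ore_ring_def)

lemma ev_eq:
  assumes c: "c \<in> up R" and D: "finite D" "\<And>k. k \<notin> D \<Longrightarrow> c k = \<zero>\<^bsub>R\<^esub>"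
  shows "ev c = (\<Oplus>\<^bsub>A\<^esub>j\<in>D. \<iota> (c j) \<otimes>\<^bsub>A\<^esub> x [^]\<^bsub>A\<^esub> j)"
  unfolding skew_eval_def
proof (rule A.add.finprod_mono_neutral_cong_left[OF D(1)])
  show "{j. c j \<noteq> \<zero>\<^bsub>R\<^esub>} \<subseteq> D" using D(2) by blast
qed (use up_carrier[OF c] in \<open>auto simp: iota_zero\<close>)

lemma ev_closed: "c \<in> up R \<Longrightarrow> ev c \<in> carrier A"
  unfolding skew_eval_def by (rule A.finsum_closed) (auto dest: up_carrier)

lemma ev_zero: "ev (\<lambda>_. \<zero>\<^bsub>R\<^esub>) = \<zero>\<^bsub>A\<^esub>"
  by (simp add: skew_eval_def)

text \<open>Horner's scheme: with coefficients on the left of the powers, right multiplication by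
  \<open>x\<close> merely shifts them.\<close>

lemma ev_cons:
  assumes r: "r \<in> carrier R" and c: "c \<in> up R"
  shows "ev (case_nat r c) = \<iota> r \<oplus>\<^bsub>A\<^esub> ev c \<otimes>\<^bsub>A\<^esub> x"
proof -
  obtain n where n: "\<And>k. n \<le> k \<Longrightarrow> c k = \<zero>\<^bsub>R\<^esub>" using up_bounded[OF c] by blast
  note [simp] = up_carrier[OF c]
  have "ev (case_nat r c) = (\<Oplus>\<^bsub>A\<^esub>j\<in>{..Suc n}. \<iota> (case_nat r c j) \<otimes>\<^bsub>A\<^esub> x [^]\<^bsub>A\<^esub> j)"
    using n by (intro ev_eq up_case_nat r c) (auto split: nat.split)
  also have "\<dots> = (\<Oplus>\<^bsub>A\<^esub>j\<in>{..n}. \<iota> (c j) \<otimes>\<^bsub>A\<^esub> x [^]\<^bsub>A\<^esub> Suc j) \<oplus>\<^bsub>A\<^esub> \<iota> r"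
    using r by (subst A.finsum_Suc2) (auto split: nat.split)
  also have "(\<Oplus>\<^bsub>A\<^esub>j\<in>{..n}. \<iota> (c j) \<otimes>\<^bsub>A\<^esub> x [^]\<^bsub>A\<^esub> Suc j) =
      (\<Oplus>\<^bsub>A\<^esub>j\<in>{..n}. \<iota> (c j) \<otimes>\<^bsub>A\<^esub> x [^]\<^bsub>A\<^esub> j \<otimes>\<^bsub>A\<^esub> x)"
    by (rule A.finsum_cong') (auto simp: A.m_assoc)
  also have "\<dots> = (\<Oplus>\<^bsub>A\<^esub>j\<in>{..n}. \<iota> (c j) \<otimes>\<^bsub>A\<^esub> x [^]\<^bsub>A\<^esub> j) \<otimes>\<^bsub>A\<^esub> x"
    by (rule A.finsum_ldistr[symmetric]) auto
  also have "(\<Oplus>\<^bsub>A\<^esub>j\<in>{..n}. \<iota> (c j) \<otimes>\<^bsub>A\<^esub> x [^]\<^bsub>A\<^esub> j) = ev c"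
    using n by (intro ev_eq[symmetric] c) auto
  finally show ?thesis using r ev_closed[OF c] by (simp add: A.a_comm)
qed

lemma coeffs_up: "a \<in> carrier A \<Longrightarrow> coeffs a \<in> up R"
  and ev_coeffs: "a \<in> carrier A \<Longrightarrow> ev (coeffs a) = a"
  using theI'[OF ev_unique, of a] by (simp_all add: skew_coeffs_def)

lemma coeffs_closed: "a \<in> carrier A \<Longrightarrow> coeffs a j \<in> carrier R"
  by (simp add: coeffs_up up_carrier)

lemma coeffs_ev: "c \<in> up R \<Longrightarrow> coeffs (ev c) = c"
  using ev_unique[OF ev_closed, of c] coeffs_up[OF ev_closed, of c] ev_coeffs[OF ev_closed, of c]
  by metis

lemma coeffs_zero: "coeffs \<zero>\<^bsub>A\<^esub> = (\<lambda>_. \<zero>\<^bsub>R\<^esub>)"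
  using coeffs_ev[OF up_zero] by (simp add: ev_zero R.abelian_group_axioms)

lemma coeffs_cons:
  "r \<in> carrier R \<Longrightarrow> a \<in> carrier A \<Longrightarrow> coeffs (\<iota> r \<oplus>\<^bsub>A\<^esub> a \<otimes>\<^bsub>A\<^esub> x) = case_nat r (coeffs a)"
  using coeffs_ev[OF up_case_nat, of r "coeffs a"] by (simp add: ev_cons coeffs_up ev_coeffs)

lemma coeffs_iota: "r \<in> carrier R \<Longrightarrow> coeffs (\<iota> r) = case_nat r (\<lambda>_. \<zero>\<^bsub>R\<^esub>)"
  using coeffs_cons[of r "\<zero>\<^bsub>A\<^esub>"] by (simp add: coeffs_zero)

lemma coeffs_x: "a \<in> carrier A \<Longrightarrow> coeffs (a \<otimes>\<^bsub>A\<^esub> x) = case_nat \<zero>\<^bsub>R\<^esub> (coeffs a)"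
  using coeffs_cons[of "\<zero>\<^bsub>R\<^esub>" a] by (simp add: iota_zero)

lemma skew_cases:
  assumes "a \<in> carrier A"
  obtains r b where "r \<in> carrier R" "b \<in> carrier A" "a = \<iota> r \<oplus>\<^bsub>A\<^esub> b \<otimes>\<^bsub>A\<^esub> x"
proof
  let ?c = "coeffs a"
  show "?c 0 \<in> carrier R" "ev (\<lambda>k. ?c (Suc k)) \<in> carrier A"
    using assms by (auto intro: coeffs_closed ev_closed up_shift coeffs_up)
  have "a = ev (case_nat (?c 0) (\<lambda>k. ?c (Suc k)))"
    using assms unfolding case_nat_shift by (simp add: ev_coeffs)
  then show "a = \<iota> (?c 0) \<oplus>\<^bsub>A\<^esub> ev (\<lambda>k. ?c (Suc k)) \<otimes>\<^bsub>A\<^esub> x"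
    using assms by (simp add: ev_cons coeffs_closed up_shift coeffs_up)
qed

text \<open>This is \<open>up_induct\<close> transported along \<open>ev\<close>. Facts about the
  action of \<open>A\<close> are reduced by it to constants and right multiplication by
  \<open>x\<close>.\<close>

lemma skew_induct [consumes 1, case_names zero cons]:
  assumes a: "a \<in> carrier A"
    and zero: "P \<zero>\<^bsub>A\<^esub>"
    and cons: "\<And>r a. r \<in> carrier R \<Longrightarrow> a \<in> carrier A \<Longrightarrow> P a \<Longrightarrow> P (\<iota> r \<oplus>\<^bsub>A\<^esub> a \<otimes>\<^bsub>A\<^esub> x)"
  shows "P a"
proof -
  have "P (ev c)" if "c \<in> up R" for c
    using that
  proof (induction rule: up_induct)
    case zero
    then show ?case using \<open>P \<zero>\<^bsub>A\<^esub>\<close> by (simp add: ev_zero)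
  next
    case (cons r c)
    then show ?case using assms(3) by (simp add: ev_cons ev_closed)
  qed
  from this[OF coeffs_up[OF a]] show ?thesis using a by (simp add: ev_coeffs)
qed

section \<open>Cancellation of \<open>x\<close> and the second product rule for \<delta>\<close>

lemma x_right_cancel:
  assumes "a \<in> carrier A" "b \<in> carrier A" "a \<otimes>\<^bsub>A\<^esub> x = b \<otimes>\<^bsub>A\<^esub> x"
  shows "a = b"
proof -
  have "case_nat \<zero>\<^bsub>R\<^esub> (coeffs a) = case_nat \<zero>\<^bsub>R\<^esub> (coeffs b)"
    using coeffs_x[OF assms(1)] coeffs_x[OF assms(2)] assms(3) by simp
  then have "coeffs a = coeffs b"
    by (metis (no_types) fun_eq_iff old.nat.simps(5))
  then show ?thesis using assms ev_coeffs by metis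
qed

lemma sigma_carrier: "r \<in> carrier R \<Longrightarrow> \<sigma> r \<in> carrier R"
  using sigma_iso ring_hom_closed by (fastforce simp: ring_iso_def)

lemma delta_carrier: "r \<in> carrier R \<Longrightarrow> \<delta> r \<in> carrier R"
  using skew_der by (auto simp: skew_derivation_def)

text \<open>After the outer \<open>x\<close> is cancelled, \<open>x \<iota> r = (\<iota> (\<sigma>
  r) + x \<iota> (\<delta> r)) x\<close> exposes another right factor \<open>x\<close>. Cancelling
  that one as well leaves an element whose constant coefficient is \<open>\<sigma> r\<close>, and
  \<sigma> is injective.\<close>

lemma x_iota_x_cancel:
  assumes rs: "r \<in> carrier R" "s \<in> carrier R"
    and eq: "x \<otimes>\<^bsub>A\<^esub> \<iota> r \<otimes>\<^bsub>A\<^esub> x = x \<otimes>\<^bsub>A\<^esub> \<iota> s \<otimes>\<^bsub>A\<^esub> x"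
  shows "r = s"
proof -
  note [simp] = sigma_carrier delta_carrier
  have *: "x \<otimes>\<^bsub>A\<^esub> \<iota> t = (\<iota> (\<sigma> t) \<oplus>\<^bsub>A\<^esub> x \<otimes>\<^bsub>A\<^esub> \<iota> (\<delta> t)) \<otimes>\<^bsub>A\<^esub> x" if "t \<in> carrier R" for t
    using x_comm[OF that] that by (simp add: A.l_distr)
  have "x \<otimes>\<^bsub>A\<^esub> \<iota> r = x \<otimes>\<^bsub>A\<^esub> \<iota> s" by (rule x_right_cancel[OF _ _ eq]) (use rs in auto)
  then have "\<iota> (\<sigma> r) \<oplus>\<^bsub>A\<^esub> x \<otimes>\<^bsub>A\<^esub> \<iota> (\<delta> r) = \<iota> (\<sigma> s) \<oplus>\<^bsub>A\<^esub> x \<otimes>\<^bsub>A\<^esub> \<iota> (\<delta> s)"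
    unfolding *[OF rs(1)] *[OF rs(2)] by (rule x_right_cancel[rotated 2]) (use rs in auto)
  \<comment> \<open>By \<open>*\<close> again, \<open>x \<iota> (\<delta> t)\<close> is a right
    multiple of \<open>x\<close> and adds nothing to coefficient \<open>0\<close>.\<close>
  moreover have "coeffs (\<iota> (\<sigma> t) \<oplus>\<^bsub>A\<^esub> x \<otimes>\<^bsub>A\<^esub> \<iota> (\<delta> t)) 0 = \<sigma> t" if "t \<in> carrier R" for t
    using that by (subst *) (auto simp: coeffs_cons)
  ultimately have "\<sigma> r = \<sigma> s" using rs by metis
  then show ?thesis
    using sigma_iso rs by (auto simp: ring_iso_def bij_betw_def dest: inj_onD)
qed

text \<open>Expanding \<open>x (r s) = (x r) s\<close> with the commutation rule.\<close>
lemma delta_twisted: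
  assumes r: "r \<in> carrier R" and s: "s \<in> carrier R"
  shows "\<delta> (r \<otimes>\<^bsub>R\<^esub> s) = r \<otimes>\<^bsub>R\<^esub> \<delta> s \<oplus>\<^bsub>R\<^esub> \<delta> r \<otimes>\<^bsub>R\<^esub> \<sigma> s"
proof (rule x_iota_x_cancel)
  note [simp] = sigma_carrier delta_carrier
  have sigma_mult: "\<sigma> (r \<otimes>\<^bsub>R\<^esub> s) = \<sigma> r \<otimes>\<^bsub>R\<^esub> \<sigma> s"
    using sigma_iso r s by (auto simp: ring_iso_def ring_hom_def)
  let ?R = "\<iota> r" and ?S = "\<iota> s" and ?sR = "\<iota> (\<sigma> r)" and ?sS = "\<iota> (\<sigma> s)"
    and ?dR = "\<iota> (\<delta> r)" and ?dS = "\<iota> (\<delta> s)"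
  have cl: "?R \<in> carrier A" "?S \<in> carrier A" "?sR \<in> carrier A" "?sS \<in> carrier A"
      "?dR \<in> carrier A" "?dS \<in> carrier A" "x \<in> carrier A"
    using r s by auto
  have cancel: "v = w" if "u \<in> carrier A" "v \<in> carrier A" "w \<in> carrier A" "u \<oplus>\<^bsub>A\<^esub> v = u \<oplus>\<^bsub>A\<^esub> w" for u v w
    using that by (metis A.add.right_cancel A.a_comm)
  have "?sR \<otimes>\<^bsub>A\<^esub> ?sS \<otimes>\<^bsub>A\<^esub> x \<oplus>\<^bsub>A\<^esub> x \<otimes>\<^bsub>A\<^esub> \<iota> (\<delta> (r \<otimes>\<^bsub>R\<^esub> s)) \<otimes>\<^bsub>A\<^esub> x = x \<otimes>\<^bsub>A\<^esub> \<iota> (r \<otimes>\<^bsub>R\<^esub> s)"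
    using r s x_comm[of "r \<otimes>\<^bsub>R\<^esub> s"] by (simp add: sigma_mult iota_mult)
  also have "\<dots> = x \<otimes>\<^bsub>A\<^esub> ?R \<otimes>\<^bsub>A\<^esub> ?S" using r s cl by (simp add: iota_mult A.m_assoc)
  also have "\<dots> = ?sR \<otimes>\<^bsub>A\<^esub> (x \<otimes>\<^bsub>A\<^esub> ?S) \<oplus>\<^bsub>A\<^esub> x \<otimes>\<^bsub>A\<^esub> ?dR \<otimes>\<^bsub>A\<^esub> (x \<otimes>\<^bsub>A\<^esub> ?S)"
    using cl by (simp add: x_comm[OF r] A.l_distr A.m_assoc)
  also have "\<dots> = ?sR \<otimes>\<^bsub>A\<^esub> (?sS \<otimes>\<^bsub>A\<^esub> x \<oplus>\<^bsub>A\<^esub> x \<otimes>\<^bsub>A\<^esub> ?dS \<otimes>\<^bsub>A\<^esub> x) \<oplus>\<^bsub>A\<^esub>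
      x \<otimes>\<^bsub>A\<^esub> ?dR \<otimes>\<^bsub>A\<^esub> (?sS \<otimes>\<^bsub>A\<^esub> x \<oplus>\<^bsub>A\<^esub> x \<otimes>\<^bsub>A\<^esub> ?dS \<otimes>\<^bsub>A\<^esub> x)"
    by (simp only: x_comm[OF s])
  \<comment> \<open>The two terms that end in \<open>?dS x\<close> are collected: their common left
    factor is the right-hand side of the commutation rule for \<open>r\<close>, which the next step
    folds back to \<open>x ?R\<close>.\<close>
  also have "\<dots> = ?sR \<otimes>\<^bsub>A\<^esub> ?sS \<otimes>\<^bsub>A\<^esub> x \<oplus>\<^bsub>A\<^esub>
      ((?sR \<otimes>\<^bsub>A\<^esub> x \<oplus>\<^bsub>A\<^esub> x \<otimes>\<^bsub>A\<^esub> ?dR \<otimes>\<^bsub>A\<^esub> x) \<otimes>\<^bsub>A\<^esub> ?dS \<otimes>\<^bsub>A\<^esub> x \<oplus>\<^bsub>A\<^esub> x \<otimes>\<^bsub>A\<^esub> (?dR \<otimes>\<^bsub>A\<^esub> ?sS) \<otimes>\<^bsub>A\<^esub> x)"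
    using cl by (simp add: A.l_distr A.r_distr A.m_assoc A.a_ac)
  also have "\<dots> = ?sR \<otimes>\<^bsub>A\<^esub> ?sS \<otimes>\<^bsub>A\<^esub> x \<oplus>\<^bsub>A\<^esub>
      (x \<otimes>\<^bsub>A\<^esub> ?R \<otimes>\<^bsub>A\<^esub> ?dS \<otimes>\<^bsub>A\<^esub> x \<oplus>\<^bsub>A\<^esub> x \<otimes>\<^bsub>A\<^esub> (?dR \<otimes>\<^bsub>A\<^esub> ?sS) \<otimes>\<^bsub>A\<^esub> x)"
    by (simp only: x_comm[OF r])
  finally have "x \<otimes>\<^bsub>A\<^esub> \<iota> (\<delta> (r \<otimes>\<^bsub>R\<^esub> s)) \<otimes>\<^bsub>A\<^esub> x =
      x \<otimes>\<^bsub>A\<^esub> ?R \<otimes>\<^bsub>A\<^esub> ?dS \<otimes>\<^bsub>A\<^esub> x \<oplus>\<^bsub>A\<^esub> x \<otimes>\<^bsub>A\<^esub> (?dR \<otimes>\<^bsub>A\<^esub> ?sS) \<otimes>\<^bsub>A\<^esub> x"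
    by (rule cancel[rotated 3]) (use cl r s in auto)
  also have "\<dots> = x \<otimes>\<^bsub>A\<^esub> \<iota> (r \<otimes>\<^bsub>R\<^esub> \<delta> s \<oplus>\<^bsub>R\<^esub> \<delta> r \<otimes>\<^bsub>R\<^esub> \<sigma> s) \<otimes>\<^bsub>A\<^esub> x"
    using cl r s by (simp add: iota_add iota_mult A.l_distr A.r_distr A.m_assoc)
  finally show "x \<otimes>\<^bsub>A\<^esub> \<iota> (\<delta> (r \<otimes>\<^bsub>R\<^esub> s)) \<otimes>\<^bsub>A\<^esub> x =
      x \<otimes>\<^bsub>A\<^esub> \<iota> (r \<otimes>\<^bsub>R\<^esub> \<delta> s \<oplus>\<^bsub>R\<^esub> \<delta> r \<otimes>\<^bsub>R\<^esub> \<sigma> s) \<otimes>\<^bsub>A\<^esub> x" .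
qed (use r s in \<open>auto simp: sigma_carrier delta_carrier\<close>)

section \<open>Right ideals of \<open>A\<close> generated by coefficients\<close>

definition coeff_set :: "'r set \<Rightarrow> 'a set" where
  "coeff_set P = {a \<in> carrier A. \<forall>j. coeffs a j \<in> P}"

text \<open>Describes \<open>P A\<close> by coefficients. Right multiplication by constants mixes
  coefficients through \<sigma> and \<delta>, so being an ideal is a condition on
  \<open>coeff_set P\<close>; in the applications this set is the colon of a submodule over
  \<open>A\<close>, hence an ideal.\<close>

lemma gen_right_ideal_iota:
  assumes P: "additive_subgroup P R" and ideal: "ideal (coeff_set P) A"
  shows "gen_right_ideal A (\<iota> ` P) = coeff_set P"
proof
  interpret P: additive_subgroup P R by fact
  have "right_ideal (coeff_set P) A"
    unfolding right_ideal_def using ideal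
    by (auto intro: ideal.I_r_closed ideal.axioms)
  moreover have "\<iota> ` P \<subseteq> coeff_set P"
    by (auto simp: coeff_set_def coeffs_iota split: nat.split)
  ultimately show "gen_right_ideal A (\<iota> ` P) \<subseteq> coeff_set P"
    by (auto simp: gen_right_ideal_def)
next
  \<comment> \<open>Horner's scheme rebuilds \<open>a\<close> inside any right ideal that contains
    the image of \<open>P\<close>.\<close>
  have "a \<in> I" if a: "a \<in> coeff_set P" and I: "right_ideal I A" and PI: "\<iota> ` P \<subseteq> I" for a I
  proof -
    interpret I: additive_subgroup I A using I by (simp add: right_ideal_def)
    have "a \<in> carrier A" using a by (simp add: coeff_set_def)
    then have "(\<forall>j. coeffs a j \<in> P) \<longrightarrow> a \<in> I"
    proof (induction rule: skew_induct)
      case (cons r a)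
      show ?case
      proof
        assume "\<forall>j. coeffs (\<iota> r \<oplus>\<^bsub>A\<^esub> a \<otimes>\<^bsub>A\<^esub> x) j \<in> P"
        then have *: "case_nat r (coeffs a) j \<in> P" for j using cons by (simp add: coeffs_cons)
        from *[of 0] have "r \<in> P" by simp
        moreover have "coeffs a j \<in> P" for j using *[of "Suc j"] by simp
        ultimately show "\<iota> r \<oplus>\<^bsub>A\<^esub> a \<otimes>\<^bsub>A\<^esub> x \<in> I"
          using cons PI I by (auto simp: right_ideal_def)
      qed
    qed simp
    with a show ?thesis by (simp add: coeff_set_def)
  qed
  then show "coeff_set P \<subseteq> gen_right_ideal A (\<iota> ` P)"
    by (auto simp: gen_right_ideal_def)
qed

end

section \<open>The module of inverse polynomials over the skew Ore polynomial ring\<close>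

locale skew_ore_module = inverse_polynomials R M \<sigma> \<delta> + skew_ore R A \<sigma> \<delta> \<iota> x
  for R :: "('r, 'u) ring_scheme" (structure)
    and M :: "('r, 'm, 'w) rmodule_scheme" (structure)
    and A :: "('a, 'v) ring_scheme" (structure) and \<sigma> \<delta> \<iota> x +
  assumes nilpotent: "locally_nilpotent R \<delta>"
begin

abbreviation VA where "VA \<equiv> inv_poly_A R \<sigma> \<delta> A \<iota> x M"
abbreviation actA where "actA \<equiv> ract VA"

lemma VA_simps [simp]:
  "carrier VA = up M" "\<zero>\<^bsub>VA\<^esub> = (\<lambda>_. \<zero>\<^bsub>M\<^esub>)" "f \<oplus>\<^bsub>VA\<^esub> g = (\<lambda>i. f i \<oplus>\<^bsub>M\<^esub> g i)"
  by (simp_all add: inv_poly_A_def)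

lemma actA_eq: "actA f a l =
    (\<Oplus>\<^bsub>M\<^esub>j\<in>{j. coeffs a j \<noteq> \<zero>\<^bsub>R\<^esub>}. act f (coeffs a j) (l + j))"
  by (simp add: inv_poly_A_def Let_def)

lemma actA_eq_sum:
  assumes f: "f \<in> up M" and a: "a \<in> carrier A"
    and D: "finite D" "\<And>j. j \<notin> D \<Longrightarrow> coeffs a j = \<zero>\<^bsub>R\<^esub>"
  shows "actA f a l = (\<Oplus>\<^bsub>M\<^esub>j\<in>D. act f (coeffs a j) (l + j))"
  unfolding actA_eq
proof (rule M.add.finprod_mono_neutral_cong_left[OF D(1)])
  show "{j. coeffs a j \<noteq> \<zero>\<^bsub>R\<^esub>} \<subseteq> D" using D(2) by blast
qed (use f a in \<open>auto simp: act_zero_right coeffs_closed act_closed'\<close>)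

lemma actA_zero_right: "f \<in> up M \<Longrightarrow> actA f \<zero>\<^bsub>A\<^esub> = (\<lambda>_. \<zero>\<^bsub>M\<^esub>)"
  by (rule ext) (simp add: actA_eq coeffs_zero)

lemma actA_carrier: "f \<in> up M \<Longrightarrow> a \<in> carrier A \<Longrightarrow> actA f a l \<in> carrier M"
  unfolding actA_eq by (rule M.finsum_closed) (auto intro: act_closed' coeffs_closed)

text \<open>The index \<open>Suc l\<close> reflects that \<open>x\<close> acts as the shift. This is
  the recursion with which \<open>skew_induct\<close> yields the module axioms over
  \<open>A\<close>.\<close>

lemma actA_cons:
  assumes f: "f \<in> up M" and r: "r \<in> carrier R" and a: "a \<in> carrier A"
  shows "actA f (\<iota> r \<oplus>\<^bsub>A\<^esub> a \<otimes>\<^bsub>A\<^esub> x) = (\<lambda>l. act f r l \<oplus>\<^bsub>M\<^esub> actA f a (Suc l))"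
proof
  fix l
  obtain n where n: "\<And>k. n \<le> k \<Longrightarrow> coeffs a k = \<zero>\<^bsub>R\<^esub>"
    using up_bounded[OF coeffs_up[OF a]] by blast
  let ?b = "\<iota> r \<oplus>\<^bsub>A\<^esub> a \<otimes>\<^bsub>A\<^esub> x"
  have cb: "coeffs ?b = case_nat r (coeffs a)" using r a by (rule coeffs_cons)
  note [simp] = act_closed'[OF f] coeffs_closed[OF a] r
  have "actA f ?b l = (\<Oplus>\<^bsub>M\<^esub>j\<in>{..Suc n}. act f (case_nat r (coeffs a) j) (l + j))"
    using n r a unfolding cb[symmetric]
    by (intro actA_eq_sum[OF f]) (auto simp: cb split: nat.split)
  also have "\<dots> = (\<Oplus>\<^bsub>M\<^esub>j\<in>{..n}. act f (coeffs a j) (Suc l + j)) \<oplus>\<^bsub>M\<^esub> act f r l"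
    by (subst M.finsum_Suc2) (auto split: nat.split)
  also have "(\<Oplus>\<^bsub>M\<^esub>j\<in>{..n}. act f (coeffs a j) (Suc l + j)) = actA f a (Suc l)"
    using n by (intro actA_eq_sum[symmetric] f a) auto
  finally show "actA f ?b l = act f r l \<oplus>\<^bsub>M\<^esub> actA f a (Suc l)"
    using f a by (simp add: M.a_comm actA_carrier)
qed

lemma actA_closed:
  assumes f: "f \<in> up M"
  shows "a \<in> carrier A \<Longrightarrow> actA f a \<in> up M"
proof (induction rule: skew_induct)
  case zero
  then show ?case using f by (simp add: actA_zero_right up_zero M.abelian_group_axioms)
next
  case (cons r a)
  then show ?case
    using f by (simp add: actA_cons up_add up_shift act_closed M.abelian_group_axioms)
qed

lemma actA_above:
  assumes f: "f \<in> up M" and n: "\<And>k. n \<le> k \<Longrightarrow> f k = \<zero>\<^bsub>M\<^esub>" and a: "a \<in> carrier A" and "n \<le> l"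
  shows "actA f a l = \<zero>\<^bsub>M\<^esub>"
  using a \<open>n \<le> l\<close>
proof (induction arbitrary: l rule: skew_induct)
  case zero
  then show ?case using f by (simp add: actA_zero_right)
next
  case (cons r a)
  then show ?case using act_above[OF f _ n, of r l] f by (simp add: actA_cons)
qed

lemma actA_add_left:
  assumes f: "f \<in> up M" and g: "g \<in> up M" and a: "a \<in> carrier A"
  shows "actA (\<lambda>k. f k \<oplus>\<^bsub>M\<^esub> g k) a = (\<lambda>k. actA f a k \<oplus>\<^bsub>M\<^esub> actA g a k)"
  using a
proof (induction rule: skew_induct)
  case zero
  then show ?case using f g by (simp add: actA_zero_right up_add M.abelian_group_axioms)
next
  case (cons r a)
  then show ?case
    using f g by (simp add: actA_cons up_add M.abelian_group_axioms act_add_left act_closed'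
        actA_carrier M.a_ac)
qed

lemma actA_add_right:
  assumes f: "f \<in> up M" and a: "a \<in> carrier A" and b: "b \<in> carrier A"
  shows "actA f (a \<oplus>\<^bsub>A\<^esub> b) = (\<lambda>k. actA f a k \<oplus>\<^bsub>M\<^esub> actA f b k)"
  using a b
proof (induction arbitrary: b rule: skew_induct)
  case zero
  then show ?case using f by (simp add: actA_zero_right actA_carrier)
next
  case (cons r a)
  obtain s b' where b': "s \<in> carrier R" "b' \<in> carrier A" "b = \<iota> s \<oplus>\<^bsub>A\<^esub> b' \<otimes>\<^bsub>A\<^esub> x"
    using skew_cases[OF cons.prems] .
  have "(\<iota> r \<oplus>\<^bsub>A\<^esub> a \<otimes>\<^bsub>A\<^esub> x) \<oplus>\<^bsub>A\<^esub> b = \<iota> (r \<oplus>\<^bsub>R\<^esub> s) \<oplus>\<^bsub>A\<^esub> (a \<oplus>\<^bsub>A\<^esub> b') \<otimes>\<^bsub>A\<^esub> x"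
    using cons.hyps b' by (simp add: iota_add A.l_distr A.a_ac)
  then show ?case
    using cons.hyps b' f
    by (simp add: actA_cons cons.IH act_add_right act_closed' actA_carrier M.a_ac)
qed

lemma actA_iota: "f \<in> up M \<Longrightarrow> r \<in> carrier R \<Longrightarrow> actA f (\<iota> r) = act f r"
  using actA_cons[of f r "\<zero>\<^bsub>A\<^esub>"] by (simp add: actA_zero_right act_closed')

lemma actA_mult_x:
  "f \<in> up M \<Longrightarrow> a \<in> carrier A \<Longrightarrow> actA f (a \<otimes>\<^bsub>A\<^esub> x) = (\<lambda>l. actA f a (Suc l))"
  using actA_cons[of f "\<zero>\<^bsub>R\<^esub>" a] by (simp add: actA_zero_right act_zero_right iota_zero actA_carrier)

text \<open>The case of associativity in which the commutation rule has to be used;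
  \<open>actA_assoc\<close> combines it with the shift for right multiplication by
  \<open>x\<close>.\<close>

lemma actA_mult_iota:
  assumes f: "f \<in> up M" and "a \<in> carrier A" "r \<in> carrier R"
  shows "actA f (a \<otimes>\<^bsub>A\<^esub> \<iota> r) = act (actA f a) r"
  using assms(2,3)
proof (induction arbitrary: r rule: skew_induct)
  case zero
  then show ?case using f by (simp add: actA_zero_right act_zero_left)
next
  case (cons s a)
  let ?g = "actA f a" and ?Sg = "\<lambda>l. actA f a (Suc l)"
  have g: "?g \<in> up M" "?Sg \<in> up M" using actA_closed[OF f cons.hyps(2)] by (auto intro: up_shift)
  \<comment> \<open>Inner induction on an exponent that kills \<open>r\<close>. The rule rewrites
    \<open>a x r\<close> as \<open>a \<sigma>(r) x + a x \<delta>(r) x\<close>: the outer hypothesis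
    covers the first term, and \<open>\<delta> r\<close> in the second is killed one step earlier.
    Local nilpotency provides \<open>n\<close>, and \<open>n = 0\<close> means
    \<open>r = 0\<close>.\<close>
  have *: "actA f (a \<otimes>\<^bsub>A\<^esub> x \<otimes>\<^bsub>A\<^esub> \<iota> r) = act ?Sg r"
    if "r \<in> carrier R" "(\<delta> ^^ n) r = \<zero>\<^bsub>R\<^esub>" for n r
    using that
  proof (induction n arbitrary: r)
    case 0
    then show ?case using f g cons.hyps by (simp add: iota_zero actA_zero_right act_zero_right)
  next
    case (Suc n)
    have "a \<otimes>\<^bsub>A\<^esub> x \<otimes>\<^bsub>A\<^esub> \<iota> r = a \<otimes>\<^bsub>A\<^esub> \<iota> (\<sigma> r) \<otimes>\<^bsub>A\<^esub> x \<oplus>\<^bsub>A\<^esub> a \<otimes>\<^bsub>A\<^esub> x \<otimes>\<^bsub>A\<^esub> \<iota> (\<delta> r) \<otimes>\<^bsub>A\<^esub> x"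
    proof -
      have "a \<otimes>\<^bsub>A\<^esub> x \<otimes>\<^bsub>A\<^esub> \<iota> r = a \<otimes>\<^bsub>A\<^esub> (x \<otimes>\<^bsub>A\<^esub> \<iota> r)"
        using cons.hyps Suc.prems by (simp add: A.m_assoc)
      also have "\<dots> = a \<otimes>\<^bsub>A\<^esub> (\<iota> (\<sigma> r) \<otimes>\<^bsub>A\<^esub> x \<oplus>\<^bsub>A\<^esub> x \<otimes>\<^bsub>A\<^esub> \<iota> (\<delta> r) \<otimes>\<^bsub>A\<^esub> x)"
        by (simp only: x_comm[OF Suc.prems(1)])
      finally show ?thesis using cons.hyps Suc.prems by (simp add: A.m_assoc A.r_distr)
    qed
    moreover have "actA f (a \<otimes>\<^bsub>A\<^esub> x \<otimes>\<^bsub>A\<^esub> \<iota> (\<delta> r)) = act ?Sg (\<delta> r)"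
      using Suc.prems by (intro Suc.IH) (auto simp: funpow_swap1)
    ultimately have "actA f (a \<otimes>\<^bsub>A\<^esub> x \<otimes>\<^bsub>A\<^esub> \<iota> r) l =
        act ?g (\<sigma> r) (Suc l) \<oplus>\<^bsub>M\<^esub> act ?Sg (\<delta> r) (Suc l)" for l
      using f cons.hyps Suc.prems by (simp add: actA_add_right actA_mult_x cons.IH)
    then show ?case using Suc.prems g by (intro ext) (simp add: act_shift)
  qed
  obtain n where n: "(\<delta> ^^ n) r = \<zero>\<^bsub>R\<^esub>"
    using nilpotent cons.prems by (auto simp: locally_nilpotent_def)
  have "(\<iota> s \<oplus>\<^bsub>A\<^esub> a \<otimes>\<^bsub>A\<^esub> x) \<otimes>\<^bsub>A\<^esub> \<iota> r = \<iota> (s \<otimes>\<^bsub>R\<^esub> r) \<oplus>\<^bsub>A\<^esub> a \<otimes>\<^bsub>A\<^esub> x \<otimes>\<^bsub>A\<^esub> \<iota> r"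
    using cons by (simp add: A.l_distr iota_mult)
  then have "actA f ((\<iota> s \<oplus>\<^bsub>A\<^esub> a \<otimes>\<^bsub>A\<^esub> x) \<otimes>\<^bsub>A\<^esub> \<iota> r) = (\<lambda>l. act (act f s) r l \<oplus>\<^bsub>M\<^esub> act ?Sg r l)"
    using f cons.hyps cons.prems *[OF cons.prems n]
    by (simp add: actA_add_right actA_iota act_assoc)
  also have "\<dots> = act (actA f (\<iota> s \<oplus>\<^bsub>A\<^esub> a \<otimes>\<^bsub>A\<^esub> x)) r"
    using f g cons.hyps cons.prems by (simp add: actA_cons act_add_left act_closed)
  finally show ?case .
qed

lemma actA_assoc:
  assumes f: "f \<in> up M" and a: "a \<in> carrier A" and b: "b \<in> carrier A"
  shows "actA f (a \<otimes>\<^bsub>A\<^esub> b) = actA (actA f a) b"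
  using b
proof (induction rule: skew_induct)
  case zero
  then show ?case using f a by (simp add: actA_zero_right actA_closed)
next
  case (cons r b)
  have "a \<otimes>\<^bsub>A\<^esub> (\<iota> r \<oplus>\<^bsub>A\<^esub> b \<otimes>\<^bsub>A\<^esub> x) = a \<otimes>\<^bsub>A\<^esub> \<iota> r \<oplus>\<^bsub>A\<^esub> a \<otimes>\<^bsub>A\<^esub> b \<otimes>\<^bsub>A\<^esub> x"
    using cons.hyps a by (simp add: A.r_distr A.m_assoc)
  then show ?case
    using cons f a
    by (simp add: actA_add_right actA_mult_iota actA_mult_x actA_cons actA_iota actA_closed)
qed

lemma abelian_group_VA: "abelian_group VA"
  by (rule abelian_groupI) (use abelian_groupE[OF abelian_group_V] in \<open>simp_all\<close>)

lemma right_module_VA: "right_module A VA"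
  using actA_iota[of _ "\<one>\<^bsub>R\<^esub>"]
  by (intro right_module.intro right_module_axioms.intro A.ring_axioms abelian_group_VA)
    (auto simp: actA_closed actA_add_left actA_add_right actA_assoc act_one iota_one)

sublocale VA: right_module A VA
  by (rule right_module_VA)

text \<open>\<open>A\<close> is generated by \<open>R\<close> and \<open>x\<close>, and
  \<open>x\<close> acts as the shift. Leading coefficients can thus be studied over
  \<open>R\<close>, with stability under the shift treated separately.\<close>

lemma rsubmodule_A_iff:
  "rsubmodule A VA K \<longleftrightarrow> rsubmodule R V K \<and> (\<forall>v\<in>K. (\<lambda>k. v (Suc k)) \<in> K)"
    (is "?L \<longleftrightarrow> ?R")
proof
  assume K: ?L
  have sub: "K \<subseteq> up M" using VA.rsubmodule_sub[OF K] by simp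
  have "act v r \<in> K" if "v \<in> K" "r \<in> carrier R" for v r
    using VA.rsubmodule_ract[OF K that(1), of "\<iota> r"] that sub by (auto simp: actA_iota)
  moreover have "(\<lambda>k. v (Suc k)) \<in> K" if "v \<in> K" for v
  proof -
    have v: "v \<in> up M" using that sub by auto
    have "actA v (\<one>\<^bsub>A\<^esub> \<otimes>\<^bsub>A\<^esub> x) = (\<lambda>k. v (Suc k))"
      using v actA_iota[OF v, of "\<one>\<^bsub>R\<^esub>"] by (simp only: actA_mult_x A.one_closed iota_one act_one R.one_closed)
    then show ?thesis using VA.rsubmodule_ract[OF K that, of "\<one>\<^bsub>A\<^esub> \<otimes>\<^bsub>A\<^esub> x"] by simp
  qed
  ultimately show ?R using K unfolding VA.rsubmodule_iff V.rsubmodule_iff by auto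
next
  assume K: ?R
  then have sub: "K \<subseteq> up M" by (auto simp: V.rsubmodule_iff)
  have "actA v a \<in> K" if v: "v \<in> K" and "a \<in> carrier A" for v a
    using that(2)
  proof (induction rule: skew_induct)
    case zero
    then show ?case using K v sub by (auto simp: actA_zero_right V.rsubmodule_iff)
  next
    case (cons r a)
    then have "act v r \<in> K" "(\<lambda>k. actA v a (Suc k)) \<in> K"
      using K v by (auto simp: V.rsubmodule_iff)
    then show ?case using K cons v sub by (auto simp: actA_cons V.rsubmodule_iff)
  qed
  then show ?L using K by (auto simp: VA.rsubmodule_iff V.rsubmodule_iff)
qed

end

section \<open>Leading coefficients\<close>

context inverse_polynomials
begin

text \<open>The coefficient at \<open>k\<close> may vanish: elements of lower degree count too,
  which makes \<open>lead K k\<close> closed under sums.\<close>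

definition lead :: "(nat \<Rightarrow> 'b) set \<Rightarrow> nat \<Rightarrow> 'b set" where
  "lead K k = {v k | v. v \<in> K \<and> (\<forall>i>k. v i = \<zero>\<^bsub>M\<^esub>)}"

text \<open>For \<open>k = 0\<close> this is the copy of \<open>N\<close> among the constants, for
  \<open>N = carrier M\<close> it collects everything of degree at most \<open>k\<close>, and for
  general \<open>N\<close> it enlarges a maximal submodule in \<open>maximal_lead\<close>.\<close>

definition polys_with_lead :: "'b set \<Rightarrow> nat \<Rightarrow> (nat \<Rightarrow> 'b) set" where
  "polys_with_lead N k = {v \<in> up M. v k \<in> N \<and> (\<forall>i>k. v i = \<zero>\<^bsub>M\<^esub>)}"

definition monomial :: "'b \<Rightarrow> nat \<Rightarrow> nat \<Rightarrow> 'b" where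
  "monomial m k = (\<lambda>i. if i = k then m else \<zero>\<^bsub>M\<^esub>)"

lemma monomial_up: "m \<in> carrier M \<Longrightarrow> monomial m k \<in> up M"
proof -
  assume m: "m \<in> carrier M"
  have "\<forall>i\<ge>Suc k. monomial m k i = \<zero>\<^bsub>M\<^esub>" by (simp add: monomial_def)
  moreover have "\<forall>i. monomial m k i \<in> carrier M" using m by (simp add: monomial_def)
  ultimately show ?thesis unfolding up_iff by blast
qed

lemma monomial_same [simp]: "monomial m k k = m"
  and monomial_above: "k < i \<Longrightarrow> monomial m k i = \<zero>\<^bsub>M\<^esub>"
  by (simp_all add: monomial_def)

lemma act_above': "f \<in> up M \<Longrightarrow> r \<in> carrier R \<Longrightarrow> (\<And>i. k < i \<Longrightarrow> f i = \<zero>\<^bsub>M\<^esub>) \<Longrightarrow> k < l \<Longrightarrow>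
    act f r l = \<zero>\<^bsub>M\<^esub>"
  by (rule act_above[of f r "Suc k"]) auto

lemma leadI: "v \<in> K \<Longrightarrow> (\<And>i. k < i \<Longrightarrow> v i = \<zero>\<^bsub>M\<^esub>) \<Longrightarrow> v k \<in> lead K k"
  by (auto simp: lead_def)

lemma rsubmodule_polys_with_lead:
  assumes N: "rsubmodule R M N"
  shows "rsubmodule R V (polys_with_lead N k)"
  unfolding V.rsubmodule_iff
proof (intro conjI ballI)
  fix v r assume "v \<in> polys_with_lead N k" and r: "r \<in> carrier R"
  then have v: "v \<in> up M" "v k \<in> N" "\<And>i. k < i \<Longrightarrow> v i = \<zero>\<^bsub>M\<^esub>"
    by (auto simp: polys_with_lead_def)
  have "act v r k \<in> N"
    using act_top[OF v(1) r v(3)] rsubmodule_ract[OF N v(2)] r by (simp add: sinv_funpow_closed)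
  then show "v \<bullet>\<^bsub>V\<^esub> r \<in> polys_with_lead N k"
    using act_above'[OF v(1) r v(3)] v(1) r by (simp add: polys_with_lead_def act_closed)
qed (auto simp: polys_with_lead_def up_zero up_add M.abelian_group_axioms rsubmodule_zero[OF N]
    rsubmodule_add[OF N])

lemma rsubmodule_lead:
  assumes K: "rsubmodule R V K"
  shows "rsubmodule R M (lead K k)"
  unfolding rsubmodule_iff
proof (intro conjI ballI)
  have sub: "K \<subseteq> up M" using V.rsubmodule_sub[OF K] by simp
  then show "lead K k \<subseteq> carrier M" by (auto simp: lead_def up_carrier)
  show "\<zero>\<^bsub>M\<^esub> \<in> lead K k" using leadI[OF V.rsubmodule_zero[OF K]] by simp
  fix a assume "a \<in> lead K k"
  then obtain v where v: "v \<in> K" "v k = a" "\<And>i. k < i \<Longrightarrow> v i = \<zero>\<^bsub>M\<^esub>" by (auto simp: lead_def)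
  {
    fix b assume "b \<in> lead K k"
    then obtain w where w: "w \<in> K" "w k = b" "\<And>i. k < i \<Longrightarrow> w i = \<zero>\<^bsub>M\<^esub>"
      by (auto simp: lead_def)
    from leadI[OF V.rsubmodule_add[OF K v(1) w(1)], of k] v w
    show "a \<oplus>\<^bsub>M\<^esub> b \<in> lead K k" by simp
  next
    fix r assume r: "r \<in> carrier R"
    have v': "v \<in> up M" using v sub by auto
    \<comment> \<open>Acting by \<open>(\<sigma> ^^ k) r\<close> cancels the twist by
      \<open>\<sigma>' ^^ k\<close> that \<open>act_top\<close> puts on the top coefficient.\<close>
    have s: "(\<sigma> ^^ k) r \<in> carrier R" using r by (rule sigma_funpow_closed)
    have "act v ((\<sigma> ^^ k) r) k \<in> lead K k"
      using V.rsubmodule_ract[OF K v(1) s] act_above'[OF v' s v(3)] by (intro leadI) simp_all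
    then show "a \<bullet>\<^bsub>M\<^esub> r \<in> lead K k"
      using act_top[OF v' s v(3)] r v(2) by (simp add: sinv_sigma_funpow)
  }
qed

text \<open>Subtracting an element of \<open>K\<close> with the same coefficient at \<open>n\<close>
  lowers the degree, and \<open>below\<close> takes care of the difference.\<close>

lemma lead_mem:
  assumes K: "rsubmodule R V K" and v: "v \<in> up M" "v n \<in> lead K n"
      "\<And>i. n < i \<Longrightarrow> v i = \<zero>\<^bsub>M\<^esub>"
    and below: "\<And>u. u \<in> up M \<Longrightarrow> (\<And>i. n \<le> i \<Longrightarrow> u i = \<zero>\<^bsub>M\<^esub>) \<Longrightarrow> u \<in> K"
  shows "v \<in> K"
proof -
  obtain w where w: "w \<in> K" "w n = v n" "\<And>i. n < i \<Longrightarrow> w i = \<zero>\<^bsub>M\<^esub>"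
    using v(2) by (auto simp: lead_def)
  have w': "w \<in> up M" using w(1) V.rsubmodule_sub[OF K] by auto
  note [simp] = up_carrier[OF w'] up_carrier[OF v(1)]
  have "v i \<ominus>\<^bsub>M\<^esub> w i = \<zero>\<^bsub>M\<^esub>" if "n \<le> i" for i
    using v(3)[of i] w(2) w(3)[of i] that by (cases "i = n") (auto simp: a_minus_def M.r_neg)
  then have "(\<lambda>i. v i \<ominus>\<^bsub>M\<^esub> w i) \<in> K"
    using up_add[OF M.abelian_group_axioms v(1) up_minus[OF M.abelian_group_axioms w']]
    by (intro below) (simp_all add: a_minus_def)
  from V.rsubmodule_add[OF K this w(1)] show ?thesis
    by (simp add: a_minus_def M.a_assoc M.l_neg)
qed

lemma lead_full:
  assumes K: "rsubmodule R V K" and "\<And>k. k < n \<Longrightarrow> lead K k = carrier M"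
    and "v \<in> up M" "\<And>i. n \<le> i \<Longrightarrow> v i = \<zero>\<^bsub>M\<^esub>"
  shows "v \<in> K"
  using assms(2-)
proof (induction n arbitrary: v)
  case 0
  then have "v = (\<lambda>_. \<zero>\<^bsub>M\<^esub>)" by auto
  then show ?case using V.rsubmodule_zero[OF K] by simp
next
  case (Suc n)
  then show ?case by (intro lead_mem[OF K, of v n]) (auto simp: up_carrier)
qed

lemma lead_proper:
  assumes K: "rsubmodule R V K" and "K \<noteq> up M"
  obtains k where "lead K k \<noteq> carrier M"
proof (rule ccontr)
  assume "\<not> thesis"
  then have full: "lead K k = carrier M" for k using that by auto
  have "v \<in> K" if v: "v \<in> up M" for v
  proof -
    obtain n where n: "\<And>k. n \<le> k \<Longrightarrow> v k = \<zero>\<^bsub>M\<^esub>" using up_bounded[OF v] by blast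
    show ?thesis by (rule lead_full[OF K full v n])
  qed
  then have "K = up M" using V.rsubmodule_sub[OF K] by auto
  with assms(2) show False ..
qed

text \<open>For \<open>N\<close> above the lead, maximality of \<open>K\<close> leaves two values
  for \<open>?X + K\<close>. If it is \<open>K\<close>, the monomials with coefficient in
  \<open>N\<close> lie in \<open>K\<close>, so \<open>N\<close> is the lead. If it is everything,
  each \<open>m x^-k\<close> splits over \<open>?X\<close> and \<open>K\<close>, and the
  coefficients at \<open>k\<close> put \<open>m\<close> into \<open>N\<close>.\<close>

lemma maximal_lead:
  assumes max: "maximal_rsubmodule R V K" and lead: "lead K k \<noteq> carrier M"
  shows "maximal_rsubmodule R M (lead K k)"
  unfolding maximal_rsubmodule_def
proof (intro conjI allI impI)
  have K: "rsubmodule R V K" using max by (simp add: maximal_rsubmodule_def)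
  show "rsubmodule R M (lead K k)" using rsubmodule_lead[OF K] .
  fix N assume "rsubmodule R M N \<and> lead K k \<subseteq> N"
  then have N: "rsubmodule R M N" and le: "lead K k \<subseteq> N" by auto
  let ?X = "polys_with_lead N k"
  have X: "rsubmodule R V ?X" using rsubmodule_polys_with_lead[OF N] .
  have mono: "monomial m k \<in> ?X" if "m \<in> N" for m
    using that rsubmodule_sub[OF N] by (auto simp: polys_with_lead_def monomial_up monomial_above)
  have "K \<subseteq> ?X <+>\<^bsub>V\<^esub> K"
  proof
    fix v assume v: "v \<in> K"
    then have "v \<in> up M" using V.rsubmodule_sub[OF K] by auto
    then have "v = \<zero>\<^bsub>V\<^esub> \<oplus>\<^bsub>V\<^esub> v" by (simp add: up_carrier)
    then show "v \<in> ?X <+>\<^bsub>V\<^esub> K" using V.set_addI[OF V.rsubmodule_zero[OF X] v] by simp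
  qed
  then have "?X <+>\<^bsub>V\<^esub> K = K \<or> ?X <+>\<^bsub>V\<^esub> K = up M"
    using max V.rsubmodule_set_add[OF X K] by (auto simp: maximal_rsubmodule_def)
  then show "N = lead K k \<or> N = carrier M"
  proof
    assume *: "?X <+>\<^bsub>V\<^esub> K = K"
    have "m \<in> lead K k" if m: "m \<in> N" for m
    proof -
      have "monomial m k \<in> up M" using m rsubmodule_sub[OF N] by (auto intro: monomial_up)
      then have "monomial m k = monomial m k \<oplus>\<^bsub>V\<^esub> \<zero>\<^bsub>V\<^esub>" by (simp add: up_carrier)
      then have "monomial m k \<in> K"
        using V.set_addI[OF mono[OF m] V.rsubmodule_zero[OF K]] * by simp
      from leadI[OF this, of k] show ?thesis by (simp add: monomial_above)
    qed
    with le show ?thesis by auto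
  next
    assume *: "?X <+>\<^bsub>V\<^esub> K = up M"
    have "m \<in> N" if m: "m \<in> carrier M" for m
    proof -
      have "monomial m k \<in> ?X <+>\<^bsub>V\<^esub> K" using * monomial_up[OF m] by simp
      then obtain w u where w: "w \<in> ?X" and u: "u \<in> K" and eq: "monomial m k = w \<oplus>\<^bsub>V\<^esub> u"
        by (auto simp: set_add_def')
      have u': "u \<in> up M" using u V.rsubmodule_sub[OF K] by auto
      have eq': "monomial m k i = w i \<oplus>\<^bsub>M\<^esub> u i" for i using fun_cong[OF eq, of i] by simp
      have w': "w k \<in> N" "\<And>i. k < i \<Longrightarrow> w i = \<zero>\<^bsub>M\<^esub>" using w by (auto simp: polys_with_lead_def)
      \<comment> \<open>Both \<open>m x^-k\<close> and \<open>w\<close> have degree at most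
        \<open>k\<close>, hence so does \<open>u\<close>, and its coefficient at \<open>k\<close>
        counts for \<open>lead K k\<close>.\<close>
      have "u i = \<zero>\<^bsub>M\<^esub>" if "k < i" for i
        using eq'[of i] w'(2)[OF that] up_carrier[OF u', of i] monomial_above[OF that] by simp
      from leadI[OF u this] have "u k \<in> N" using le by blast
      then show ?thesis
        using eq'[of k] w'(1) rsubmodule_add[OF N] by simp
    qed
    with rsubmodule_sub[OF N] show ?thesis by auto
  qed
qed (use lead in auto)

end

section \<open>Attached primes of the module of inverse polynomials\<close>

locale compatible_skew_ore_module = skew_ore_module +
  assumes compatible: "completely_compatible R \<sigma> \<delta> V"
begin

text \<open>Compatibility is assumed for quotients of \<open>M[x^-1]\<close>. The submodule of
  constants from \<open>N\<close> carries it over to \<open>M / N\<close>, which makes annihilators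
  of quotients of \<open>M\<close> stable under \<sigma> and \<delta>.\<close>

lemma
  assumes N: "rsubmodule R M N" and r: "r \<in> carrier R"
  shows colon_sigma: "\<sigma> r \<in> colon R M N \<longleftrightarrow> r \<in> colon R M N"
    and colon_delta: "r \<in> colon R M N \<Longrightarrow> \<delta> r \<in> colon R M N"
proof -
  \<comment> \<open>The constants form a copy of \<open>M\<close> inside the inverse polynomials.\<close>
  have const: "act (case_nat m (\<lambda>_. \<zero>\<^bsub>M\<^esub>)) s \<in> polys_with_lead N 0 \<longleftrightarrow> m \<bullet>\<^bsub>M\<^esub> s \<in> N"
    and up: "case_nat m (\<lambda>_. \<zero>\<^bsub>M\<^esub>) \<in> up M"
    if "m \<in> carrier M" "s \<in> carrier R" for m s
  proof -
    show up: "case_nat m (\<lambda>_. \<zero>\<^bsub>M\<^esub>) \<in> up M"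
      using that by (intro up_case_nat up_zero M.abelian_group_axioms)
    have "act (case_nat m (\<lambda>_. \<zero>\<^bsub>M\<^esub>)) s = case_nat (m \<bullet>\<^bsub>M\<^esub> s) (\<lambda>_. \<zero>\<^bsub>M\<^esub>)"
      using that by (auto simp: act_cons up_zero M.abelian_group_axioms act_zero_left ract_closed
          fun_eq_iff split: nat.split)
    then show "act (case_nat m (\<lambda>_. \<zero>\<^bsub>M\<^esub>)) s \<in> polys_with_lead N 0 \<longleftrightarrow> m \<bullet>\<^bsub>M\<^esub> s \<in> N"
      using that by (auto simp: polys_with_lead_def ract_closed up_case_nat up_zero
          M.abelian_group_axioms split: nat.split)
  qed
  have *: "(m \<bullet>\<^bsub>M\<^esub> r \<in> N \<longleftrightarrow> m \<bullet>\<^bsub>M\<^esub> \<sigma> r \<in> N) \<and> (m \<bullet>\<^bsub>M\<^esub> r \<in> N \<longrightarrow> m \<bullet>\<^bsub>M\<^esub> \<delta> r \<in> N)"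
    if m: "m \<in> carrier M" for m
  proof -
    have "rsubmodule R V (polys_with_lead N 0)" using rsubmodule_polys_with_lead[OF N] .
    with compatible up[OF m r] r show ?thesis
      unfolding V.completely_compatible_iff[OF sigma_Pi delta_Pi]
      using const[OF m] by (metis V_simps(1,4) sigma_closed delta_closed)
  qed
  then show "\<sigma> r \<in> colon R M N \<longleftrightarrow> r \<in> colon R M N" "r \<in> colon R M N \<Longrightarrow> \<delta> r \<in> colon R M N"
    using r by (auto simp: colon_def)
qed

lemma colon_sinv: "rsubmodule R M N \<Longrightarrow> r \<in> carrier R \<Longrightarrow> \<sigma>' r \<in> colon R M N \<longleftrightarrow> r \<in> colon R M N"
  using colon_sigma[of N "\<sigma>' r"] by simp

lemma colon_sinv_funpow:
  "rsubmodule R M N \<Longrightarrow> r \<in> carrier R \<Longrightarrow> (\<sigma>' ^^ k) r \<in> colon R M N \<longleftrightarrow> r \<in> colon R M N"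
  by (induction k) (simp_all add: colon_sinv sinv_funpow_closed)

lemma colon_stable:
  assumes N: "rsubmodule R M N" and r: "r \<in> colon R M N"
  shows "r \<in> carrier R \<and> \<sigma>' r \<in> colon R M N \<and> \<delta>' r \<in> colon R M N"
proof -
  interpret ideal "colon R M N" R using ideal_colon[OF N] .
  have rR: "r \<in> carrier R" using r by (rule colon_carrier)
  then have "\<sigma>' r \<in> colon R M N" using r colon_sinv[OF N] by blast
  then show ?thesis
    using colon_delta[OF N, of "\<sigma>' r"] rR by (simp add: delta_inv_def)
qed

text \<open>The coefficients are found in \<open>P\<close> one after the other, starting with the
  constant one. For \<open>a = r + b x\<close>, the element \<open>m x^-(k+t) a x^t\<close> of
  \<open>K\<close> has degree at most \<open>k\<close> and coefficient
  \<open>m \<sigma>'^(k+t)(r)\<close> there, as the part with \<open>b x\<close> has smaller degree;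
  so \<open>r\<close> is in \<open>P\<close>. By \<open>VP\<close> the part with \<open>r\<close>
  can be subtracted, which leaves the claim for \<open>b\<close> with \<open>t + 1\<close>. This is
  why the shift \<open>t\<close> is general.\<close>

lemma coeffs_in_colon:
  assumes K: "rsubmodule R V K" and P: "P = colon R M (lead K k)"
    and VP: "\<And>v p i. v \<in> up M \<Longrightarrow> p \<in> P \<Longrightarrow> (\<lambda>l. act v p (l + i)) \<in> K"
    and a: "a \<in> carrier A"
  shows "(\<And>v. v \<in> up M \<Longrightarrow> (\<lambda>l. actA v a (l + t)) \<in> K) \<Longrightarrow> coeffs a j \<in> P"
  using a
proof (induction arbitrary: t j rule: skew_induct)
  case zero
  interpret ideal P R unfolding P by (rule ideal_colon[OF rsubmodule_lead[OF K]])
  show ?case by (simp add: coeffs_zero)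
next
  case (cons r a)
  have *: "(\<lambda>l. act v r (l + t) \<oplus>\<^bsub>M\<^esub> actA v a (l + Suc t)) \<in> K" if "v \<in> up M" for v
    using cons.prems[OF that] cons.hyps that by (simp add: actA_cons)
  have "m \<bullet>\<^bsub>M\<^esub> (\<sigma>' ^^ (k + t)) r \<in> lead K k" if m: "m \<in> carrier M" for m
  proof -
    let ?v = "monomial m (k + t)"
    have v: "?v \<in> up M" using m by (rule monomial_up)
    \<comment> \<open>Acting by \<open>a\<close> keeps the degree at most \<open>k + t\<close>, and
      \<open>l + Suc t\<close> lies beyond that as soon as \<open>k \<le> l\<close>.\<close>
    have a0: "actA ?v a (l + Suc t) = \<zero>\<^bsub>M\<^esub>" if "k \<le> l" for l
      using that by (intro actA_above[OF v _ cons.hyps(2), of "Suc (k + t)"])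
        (auto simp: monomial_above)
    have "act ?v r (k + t) \<oplus>\<^bsub>M\<^esub> actA ?v a (k + Suc t) \<in> lead K k"
    proof (rule leadI[OF *[OF v]])
      fix i assume "k < i"
      then show "act ?v r (i + t) \<oplus>\<^bsub>M\<^esub> actA ?v a (i + Suc t) = \<zero>\<^bsub>M\<^esub>"
        using act_above'[OF v cons.hyps(1), of "k + t" "i + t"] a0[of i]
        by (simp add: monomial_above)
    qed
    then show ?thesis
      using a0[of k] act_top[OF v cons.hyps(1), of "k + t"] m cons.hyps(1)
      by (simp add: monomial_above ract_closed sinv_funpow_closed)
  qed
  then have "(\<sigma>' ^^ (k + t)) r \<in> P"
    unfolding P using cons.hyps by (simp add: colon_def sinv_funpow_closed)
  then have r: "r \<in> P"
    unfolding P using colon_sinv_funpow[OF rsubmodule_lead[OF K] cons.hyps(1)] by blast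
  have "(\<lambda>l. actA v a (l + Suc t)) \<in> K" if v: "v \<in> up M" for v
  proof (rule V.rsubmodule_add_cancel[OF K VP[OF v r, of t]])
    show "(\<lambda>l. actA v a (l + Suc t)) \<in> carrier V"
      using up_shift_funpow[OF actA_closed[OF v cons.hyps(2)], of "Suc t"] by simp
    show "(\<lambda>l. act v r (l + t)) \<oplus>\<^bsub>V\<^esub> (\<lambda>l. actA v a (l + Suc t)) \<in> K" using *[OF v] by simp
  qed
  then have "coeffs a j \<in> P" for j by (rule cons.IH)
  then show ?case using r cons.hyps by (simp add: coeffs_cons split: nat.split)
qed

text \<open>The converse of \<open>coeffs_in_colon\<close>, again by Horner's scheme with growing
  shift. As \<open>K\<close> is a submodule over \<open>R\<close> only, the shifts are built into
  \<open>VP\<close>.\<close>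

lemma coeff_set_act:
  assumes K: "rsubmodule R V K"
    and VP: "\<And>v p i. v \<in> up M \<Longrightarrow> p \<in> P \<Longrightarrow> (\<lambda>l. act v p (l + i)) \<in> K"
    and a: "a \<in> carrier A" and v: "v \<in> up M"
  shows "(\<And>j. coeffs a j \<in> P) \<Longrightarrow> (\<lambda>l. actA v a (l + t)) \<in> K"
  using a
proof (induction arbitrary: t rule: skew_induct)
  case zero
  then show ?case using v V.rsubmodule_zero[OF K] by (simp add: actA_zero_right)
next
  case (cons r a)
  have c: "case_nat r (coeffs a) j \<in> P" for j
    using cons.prems[of j] cons.hyps by (simp add: coeffs_cons)
  have "r \<in> P" using c[of 0] by simp
  moreover have "coeffs a j \<in> P" for j using c[of "Suc j"] by simp
  ultimately show ?case
    using V.rsubmodule_add[OF K VP[OF v] cons.IH, of r t "Suc t"] cons.hyps v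
    by (simp add: actA_cons)
qed

text \<open>Stated for submodules over \<open>R\<close>, since it is also applied to a maximal one,
  which may fail to be stable under \<open>x\<close>.\<close>

lemma colon_eq_coeff_set:
  assumes K: "rsubmodule R V K" and P: "P = colon R M (lead K k)"
    and VP: "\<And>v p i. v \<in> up M \<Longrightarrow> p \<in> P \<Longrightarrow> (\<lambda>l. act v p (l + i)) \<in> K"
  shows "colon A VA K = coeff_set P"
proof
  show "colon A VA K \<subseteq> coeff_set P"
    using coeffs_in_colon[OF K P VP, of _ 0] by (auto simp: colon_def coeff_set_def)
  show "coeff_set P \<subseteq> colon A VA K"
    using coeff_set_act[OF K VP, where t = 0] by (auto simp: colon_def coeff_set_def)
qed

lemma gen_right_ideal_colon:
  assumes "rsubmodule A VA K" "rsubmodule R M N" "colon A VA K = coeff_set (colon R M N)"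
  shows "gen_right_ideal A (\<iota> ` colon R M N) = colon A VA K"
proof -
  interpret ideal "colon R M N" R using ideal_colon[OF assms(2)] .
  show ?thesis
    using gen_right_ideal_iota[OF is_additive_subgroup] VA.ideal_colon[OF assms(1)] assms(3)
    by simp
qed

section \<open>From attached primes of \<open>M\<close> to attached primes of
  \<open>M[x^-1]\<close>\<close>

lemma Att_inv_poly_A_of_Att:
  assumes "P \<in> Att R M"
  shows "gen_right_ideal A (\<iota> ` P) \<in> Att A VA"
proof -
  obtain N where N: "rsubmodule R M N" and NM: "N \<noteq> carrier M" and P: "P = colon R M N"
    and max: "\<And>K. rsubmodule R M K \<Longrightarrow> N \<subseteq> K \<Longrightarrow> K \<noteq> carrier M \<Longrightarrow> colon R M K = P"
  proof -
    obtain N where N: "rsubmodule R M N \<and> N \<noteq> carrier M \<and> P = colon R M N \<and>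
        (\<forall>K. rsubmodule R M K \<and> N \<subseteq> K \<and> K \<noteq> carrier M \<longrightarrow> colon R M K = P)"
      using assms[unfolded Att_iff] by (elim exE)
    show thesis by (rule that[of N]) (use N in metis)+
  qed
  \<comment> \<open>This is \<open>N[x^-1]\<close>; the quotient by it will be the coprime
    one.\<close>
  let ?N = "{v \<in> up M. \<forall>i. v i \<in> N}"
  have "act v r \<in> ?N" if v: "v \<in> ?N" and r: "r \<in> carrier R" for v r
  proof -
    have "act v r i \<in> N" for i
    proof -
      have v': "v \<in> up M" "\<And>i. v i \<in> N" using v by auto
      interpret N: abelian_subgroup N M using rsubmodule_abelian_subgroup[OF N] .
      have fin: "finite {k. i \<le> k \<and> v k \<noteq> \<zero>\<^bsub>M\<^esub>}"
        by (rule finite_subset[OF _ up_support_finite[OF v'(1)]]) auto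
      have "(\<Oplus>\<^bsub>M\<^esub>k\<in>D. v k \<bullet>\<^bsub>M\<^esub> ws k i r) \<in> N" if "finite D" for D
        using that
      proof (induction D)
        case (insert k D)
        then show ?case
          using v' r rsubmodule_ract[OF N v'(2)] rsubmodule_add[OF N]
          by (subst M.finsum_insert) (auto intro!: ract_closed up_carrier[OF v'(1)])
      qed simp
      with fin show ?thesis unfolding inv_poly_ract_def by blast
    qed
    with v r show ?thesis by (simp add: act_closed)
  qed
  then have "rsubmodule R V ?N"
    unfolding V.rsubmodule_iff using rsubmodule_zero[OF N] rsubmodule_add[OF N]
    by (auto simp: up_zero up_add M.abelian_group_axioms)
  then have N': "rsubmodule A VA ?N"
    unfolding rsubmodule_A_iff by (auto intro: up_shift)
  \<comment> \<open>\<open>M[x^-1] P\<close> lies in \<open>N[x^-1]\<close>: the recursion for the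
    action stays within \<open>P\<close> because \<open>P\<close> is stable under
    \<open>\<sigma>'\<close> and \<open>\<delta>'\<close>.\<close>
  have VP: "act v p i \<in> N" if "v \<in> up M" "p \<in> P" for v p i
    using that
  proof (induction arbitrary: p i rule: up_induct)
    case zero
    then show ?case by (simp add: act_zero_left rsubmodule_zero[OF N])
  next
    case (cons c g)
    have p: "p \<in> carrier R" "\<sigma>' p \<in> P" "\<delta>' p \<in> P"
      using colon_stable[OF N, of p] cons.prems unfolding P by auto
    then show ?case
      using cons P by (auto simp: act_cons colonD rsubmodule_add[OF N] split: nat.split)
  qed
  \<comment> \<open>As \<open>?N\<close> is itself one of these \<open>K\<close>, this claim gives
    both its colon and the coprimality of the quotient.\<close>
  have colon: "colon A VA K = coeff_set P"
    if K: "rsubmodule A VA K" and NK: "?N \<subseteq> K" and ne: "K \<noteq> carrier VA" for K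
  proof -
    have K': "rsubmodule R V K" using K by (simp add: rsubmodule_A_iff)
    obtain k where k: "lead K k \<noteq> carrier M" using lead_proper[OF K'] ne by auto
    \<comment> \<open>Every lead of \<open>K\<close> contains \<open>N\<close>, so coprimality of
      \<open>M / N\<close> identifies the colon of a proper lead with \<open>P\<close>.\<close>
    have "n \<in> lead K k" if n: "n \<in> N" for n
    proof -
      have "monomial n k \<in> ?N"
        using n rsubmodule_sub[OF N] rsubmodule_zero[OF N] monomial_up
        by (auto simp: monomial_def)
      then show ?thesis using leadI[of "monomial n k" K k] NK by (auto simp: monomial_above)
    qed
    then have P': "P = colon R M (lead K k)"
      using max[OF rsubmodule_lead[OF K'] _ k] by auto
    have "(\<lambda>l. act v p (l + i)) \<in> K" if "v \<in> up M" "p \<in> P" for v p i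
    proof -
      have "p \<in> carrier R" using that(2) unfolding P by (rule colon_carrier)
      then have "(\<lambda>l. act v p (l + i)) \<in> ?N"
        using VP[OF that] up_shift_funpow[OF act_closed[OF that(1)]] by simp
      with NK show ?thesis by auto
    qed
    then show ?thesis by (rule colon_eq_coeff_set[OF K' P'])
  qed
  have ne: "?N \<noteq> carrier VA"
  proof
    assume *: "?N = carrier VA"
    have "m \<in> N" if "m \<in> carrier M" for m
    proof -
      have "monomial m 0 \<in> ?N" unfolding * using monomial_up[OF that] by simp
      then have "monomial m 0 0 \<in> N" by blast
      then show ?thesis by simp
    qed
    with NM rsubmodule_sub[OF N] show False by auto
  qed
  have "gen_right_ideal A (\<iota> ` P) = coeff_set P"
    using gen_right_ideal_colon[OF N' N] colon[OF N' _ ne] by (simp add: P)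
  then show ?thesis
    unfolding VA.Att_iff using N' ne colon by (intro exI[of _ ?N]) auto
qed

section \<open>From attached primes of \<open>M[x^-1]\<close> to attached primes of
  \<open>M\<close>\<close>

lemma Att_of_Att_inv_poly_A:
  assumes "bass_module R V" and "I \<in> Att A VA"
  obtains P where "P \<in> Att R M" "I = gen_right_ideal A (\<iota> ` P)"
proof -
  obtain K where K: "rsubmodule A VA K" and ne: "K \<noteq> up M" and I: "I = colon A VA K"
    and max: "\<And>L. rsubmodule A VA L \<Longrightarrow> K \<subseteq> L \<Longrightarrow> L \<noteq> up M \<Longrightarrow> colon A VA L = I"
  proof -
    obtain K where K: "rsubmodule A VA K \<and> K \<noteq> up M \<and> I = colon A VA K \<and>
        (\<forall>L. rsubmodule A VA L \<and> K \<subseteq> L \<and> L \<noteq> up M \<longrightarrow> colon A VA L = I)"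
      using assms(2)[unfolded VA.Att_iff VA_simps] by (elim exE)
    show thesis by (rule that[of K]) (use K in metis)+
  qed
  have K': "rsubmodule R V K" and Kshift: "\<And>v. v \<in> K \<Longrightarrow> (\<lambda>k. v (Suc k)) \<in> K"
    using K by (auto simp: rsubmodule_A_iff)
  \<comment> \<open>\<open>H\<close> is maximal over \<open>R\<close> and may fail to be stable
    under \<open>x\<close>; the submodule \<open>L\<close> below repairs this.\<close>
  obtain H where Hmax: "maximal_rsubmodule R V H" and KH: "K \<subseteq> H"
    using assms(1) K' ne unfolding bass_module_def V_simps by blast
  have H: "rsubmodule R V H" and Hne: "H \<noteq> up M"
    and Hmax': "\<And>N. rsubmodule R V N \<Longrightarrow> H \<subseteq> N \<Longrightarrow> N = H \<or> N = up M"
    using Hmax by (auto simp: maximal_rsubmodule_def)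
  have Hup: "H \<subseteq> up M" using V.rsubmodule_sub[OF H] by simp
  \<comment> \<open>By minimality \<open>H\<close> contains everything of degree below
    \<open>k\<close> (\<open>low\<close>), so an element of degree at most \<open>k\<close> belongs
    to \<open>H\<close> as soon as its coefficient at \<open>k\<close> is in
    \<open>lead H k\<close>.\<close>
  define k where "k = (LEAST k. lead H k \<noteq> carrier M)"
  have "\<exists>k. lead H k \<noteq> carrier M" using lead_proper[OF H Hne] by blast
  then have k: "lead H k \<noteq> carrier M" unfolding k_def by (rule LeastI_ex)
  have "lead H j = carrier M" if "j < k" for j
    using not_less_Least[of j "\<lambda>k. lead H k \<noteq> carrier M"] that unfolding k_def by auto
  then have low: "v \<in> H" if "v \<in> up M" "\<And>i. k \<le> i \<Longrightarrow> v i = \<zero>\<^bsub>M\<^esub>" for v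
    using lead_full[OF H, of k v] that by blast
  let ?N = "lead H k"
  define P where "P = colon R M ?N"
  have N: "rsubmodule R M ?N" using rsubmodule_lead[OF H] .
  have PAtt: "P \<in> Att R M" unfolding P_def
    using maximal_rsubmodule_Att[OF maximal_lead[OF Hmax k]] .
  have M: "rsubmodule R M (carrier M)" unfolding rsubmodule_iff by (auto intro: ract_closed)
  let ?X = "polys_with_lead (carrier M) k"
  have X: "rsubmodule R V ?X" by (rule rsubmodule_polys_with_lead[OF M])
  \<comment> \<open>Since the lead at \<open>k\<close> is proper, \<open>?X\<close> is not inside
    \<open>H\<close>; by maximality every element is congruent modulo \<open>H\<close> to one of
    degree at most \<open>k\<close>.\<close>
  have XH: "?X <+>\<^bsub>V\<^esub> H = up M"
  proof -
    have "v \<in> ?X <+>\<^bsub>V\<^esub> H" if v: "v \<in> H" for v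
    proof -
      have "v = \<zero>\<^bsub>V\<^esub> \<oplus>\<^bsub>V\<^esub> v" using v Hup by (auto simp: up_carrier)
      then show ?thesis using V.set_addI[OF V.rsubmodule_zero[OF X] v] by simp
    qed
    moreover have "?X <+>\<^bsub>V\<^esub> H \<noteq> H"
    proof
      assume *: "?X <+>\<^bsub>V\<^esub> H = H"
      have "m \<in> ?N" if m: "m \<in> carrier M" for m
      proof -
        have "monomial m k \<in> ?X"
          using m by (simp add: polys_with_lead_def monomial_up monomial_above)
        from V.set_addI[OF this V.rsubmodule_zero[OF H]]
        have "monomial m k \<in> H"
          using m monomial_up[OF m, of k] by (simp add: * up_carrier)
        from leadI[OF this, of k] show ?thesis by (simp add: monomial_above)
      qed
      with k rsubmodule_sub[OF N] show False by auto
    qed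
    ultimately show ?thesis using Hmax'[OF V.rsubmodule_set_add[OF X H]] by blast
  qed
  \<comment> \<open>For \<open>v = w + u\<close> the part \<open>u p\<close> stays in
    \<open>H\<close>, while \<open>w p\<close> has degree at most \<open>k\<close> and its
    coefficient there is \<open>w k\<close> times \<open>(\<sigma>' ^^ k) p\<close>, which is again
    in \<open>P\<close>.\<close>
  have VP0: "act v p \<in> H" if v: "v \<in> up M" and p: "p \<in> P" for v p
  proof -
    have pR: "p \<in> carrier R" using p unfolding P_def by (rule colon_carrier)
    have "v \<in> ?X <+>\<^bsub>V\<^esub> H" using v XH by simp
    then obtain w u where w: "w \<in> ?X" and u: "u \<in> H" and vwu: "v = w \<oplus>\<^bsub>V\<^esub> u"
      by (auto simp: set_add_def')
    have w': "w \<in> up M" "\<And>i. k < i \<Longrightarrow> w i = \<zero>\<^bsub>M\<^esub>" using w by (auto simp: polys_with_lead_def)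
    have "(\<sigma>' ^^ k) p \<in> P" using p pR colon_sinv_funpow[OF N] unfolding P_def by blast
    then have "act w p k \<in> ?N"
      using act_top[OF w'(1) pR w'(2)] up_carrier[OF w'(1)] unfolding P_def by (simp add: colonD)
    then have "act w p \<in> H"
      using act_above'[OF w'(1) pR w'(2)] low
      by (intro lead_mem[OF H, of "act w p" k] act_closed w'(1) pR) auto
    moreover have "act u p \<in> H" using V.rsubmodule_ract[OF H u pR] by simp
    ultimately show ?thesis
      using V.rsubmodule_add[OF H, of "act w p" "act u p"] u Hup w'(1) pR
      by (auto simp: vwu act_add_left)
  qed
  \<comment> \<open>\<open>VP0\<close> is the case without shift. A shift of
    \<open>(c + g x^-1) p\<close> is a sum of shifts of \<open>g \<sigma>'(p)\<close> and
    \<open>g \<delta>'(p)\<close>, and both ring elements are in \<open>P\<close>.\<close>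
  have VP: "(\<lambda>l. act v p (l + i)) \<in> H" if "v \<in> up M" "p \<in> P" for v p i
    using that
  proof (induction arbitrary: p i rule: up_induct)
    case zero
    then show ?case using V.rsubmodule_zero[OF H] by (simp add: act_zero_left)
  next
    case (cons c g)
    have p: "p \<in> carrier R" "\<sigma>' p \<in> P" "\<delta>' p \<in> P"
      using colon_stable[OF N, of p] cons.prems unfolding P_def by auto
    show ?case
    proof (cases i)
      case 0
      then show ?thesis using VP0[OF up_case_nat[OF cons.hyps(1,2)] cons.prems] by simp
    next
      case (Suc j)
      then show ?thesis
        using V.rsubmodule_add[OF H cons.IH[OF p(2), of j] cons.IH[OF p(3), of "Suc j"]]
          cons.hyps p(1) by (simp add: act_cons_Suc)
    qed
  qed
  \<comment> \<open>The largest submodule over \<open>A\<close> inside \<open>H\<close>.\<close>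
  define L where "L = {v \<in> up M. \<forall>i. (\<lambda>l. v (l + i)) \<in> H}"
  \<comment> \<open>Shifts of \<open>v r\<close> unfold in the same way into shifts of tails of
    \<open>v\<close> acted on by \<open>\<sigma>' r\<close> and \<open>\<delta>' r\<close>, so
    \<open>L\<close> is closed under \<open>R\<close>.\<close>
  have Lact: "(\<lambda>l. act v r (l + i)) \<in> H"
    if "v \<in> up M" "\<And>i. (\<lambda>l. v (l + i)) \<in> H" "r \<in> carrier R" for v r i
    using that
  proof (induction arbitrary: r i rule: up_induct)
    case zero
    then show ?case using V.rsubmodule_zero[OF H] by (simp add: act_zero_left)
  next
    case (cons c g)
    have g: "(\<lambda>l. g (l + i)) \<in> H" for i using cons.prems(1)[of "Suc i"] by simp
    show ?case
    proof (cases i)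
      case 0
      then show ?thesis
        using V.rsubmodule_ract[OF H _ cons.prems(2), of "case_nat c g"] cons.prems(1)[of 0] by simp
    next
      case (Suc j)
      then show ?thesis
        using V.rsubmodule_add[OF H cons.IH[OF g, of "\<sigma>' r" j] cons.IH[OF g, of "\<delta>' r" "Suc j"]]
          cons.hyps cons.prems(2) by (simp add: act_cons_Suc)
    qed
  qed
  have "rsubmodule R V L"
    unfolding V.rsubmodule_iff
  proof (intro conjI ballI)
    fix v w assume "v \<in> L" "w \<in> L"
    then show "v \<oplus>\<^bsub>V\<^esub> w \<in> L"
      using V.rsubmodule_add[OF H] by (auto simp: L_def up_add M.abelian_group_axioms)
  next
    fix v r assume "v \<in> L" "r \<in> carrier R"
    then show "v \<bullet>\<^bsub>V\<^esub> r \<in> L" using Lact[of v r] by (simp add: L_def act_closed)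
  qed (use V.rsubmodule_zero[OF H] in \<open>auto simp: L_def up_zero M.abelian_group_axioms\<close>)
  moreover have "(\<lambda>k. v (Suc k)) \<in> L" if "v \<in> L" for v
  proof -
    have "(\<lambda>l. v (Suc (l + i))) \<in> H" for i
      using that by (auto simp: L_def dest: spec[of _ "Suc i"])
    with that show ?thesis by (auto simp: L_def up_shift)
  qed
  ultimately have L: "rsubmodule A VA L" by (simp add: rsubmodule_A_iff)
  have LH: "L \<subseteq> H"
  proof
    fix v assume "v \<in> L"
    then have "(\<lambda>l. v (l + 0)) \<in> H" unfolding L_def by blast
    then show "v \<in> H" by simp
  qed
  have KL: "K \<subseteq> L"
  proof
    fix v assume v: "v \<in> K"
    have "(\<lambda>l. v (l + i)) \<in> K" for i
    proof (induction i)
      case (Suc i)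
      from Kshift[OF this] show ?case by simp
    qed (use v in simp)
    with v KH Hup show "v \<in> L" unfolding L_def by auto
  qed
  \<comment> \<open>\<open>L\<close> is proper and contains \<open>K\<close>, so coprimality of the
    quotient by \<open>K\<close> gives both the same colon.\<close>
  have "L \<noteq> up M" using LH Hup Hne by auto
  with max[OF L KL] have IL: "I = colon A VA L" by simp
  \<comment> \<open>The upper bound is inherited from \<open>H\<close>, whose colon is already
    known; the lower bound holds because all shifts of \<open>M[x^-1] P\<close> lie in
    \<open>L\<close>.\<close>
  have "colon A VA L = coeff_set P"
  proof
    show "colon A VA L \<subseteq> coeff_set P"
      using colon_mono[OF LH, of A VA] colon_eq_coeff_set[OF H P_def VP] by auto
    have L': "rsubmodule R V L" using L by (simp add: rsubmodule_A_iff)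
    have "(\<lambda>l. act v p (l + i)) \<in> L" if "v \<in> up M" "p \<in> P" for v p i
    proof -
      have "p \<in> carrier R" using that(2) unfolding P_def by (rule colon_carrier)
      then have "(\<lambda>l. act v p (l + i)) \<in> up M" using that by (intro up_shift_funpow act_closed)
      moreover have "(\<lambda>l. act v p (l + j + i)) \<in> H" for j
        using VP[OF that, of "j + i"] by (simp add: add.assoc)
      ultimately show ?thesis by (simp add: L_def)
    qed
    then show "coeff_set P \<subseteq> colon A VA L"
      using coeff_set_act[OF L', where t = 0 and P = P] by (auto simp: colon_def coeff_set_def)
  qed
  then have "I = gen_right_ideal A (\<iota> ` P)"
    using gen_right_ideal_colon[OF L N] by (simp add: IL P_def)
  with PAtt that show thesis by blast
qed

end

theorem theorem3p12:
  fixes R :: "('r, 'u) ring_scheme"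
    and \<sigma> \<delta> :: "'r \<Rightarrow> 'r"
    and A :: "('a, 'v) ring_scheme"
    and \<iota> :: "'r \<Rightarrow> 'a"
    and x :: 'a
    and M :: "('r, 'm, 'w) rmodule_scheme"
  assumes "ring R"
    and "\<sigma> \<in> ring_iso R R"
    and "skew_derivation R \<sigma> \<delta>"
    and "locally_nilpotent R \<delta>"
    and "skew_ore_ring R \<sigma> \<delta> A \<iota> x"
    and "right_module R M"
    and "completely_compatible R \<sigma> \<delta> (inv_poly_R R \<sigma> \<delta> M)"
    and "bass_module R (inv_poly_R R \<sigma> \<delta> M)"
  shows "Att A (inv_poly_A R \<sigma> \<delta> A \<iota> x M) =
         {gen_right_ideal A (\<iota> ` P) | P. P \<in> Att R M}"
proof -
  have "ring A" using assms(5) by (simp add: skew_ore_ring_def)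
  \<comment> \<open>The ring comes first: its \<open>delta_twisted\<close> provides the rule
    \<open>twist\<close> on which the module locales rest.\<close>
  then interpret O: skew_ore R A \<sigma> \<delta> \<iota> x
    using assms by (intro skew_ore.intro skew_ore_axioms.intro)
  interpret compatible_skew_ore_module R M A \<sigma> \<delta> \<iota> x
    using assms O.delta_twisted O.skew_ore_axioms
    by (intro compatible_skew_ore_module.intro compatible_skew_ore_module_axioms.intro
        skew_ore_module.intro skew_ore_module_axioms.intro inverse_polynomials.intro
        inverse_polynomials_axioms.intro)
  show ?thesis
    using Att_inv_poly_A_of_Att Att_of_Att_inv_poly_A[OF assms(8)] by blast
qed

end
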